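(* Let $a,b,c$ be non-negative integers with $a\le b$. Then the number of lozenge tilings of the region $S_{a,b,c}$ is \[ M(S_{a,b,c})=\frac{(c+a+2)_{b-a}\,(2c+b+3)_{a-1}\,\big[(2b-a+2)c+(b+1)(b+2)\big]}{(a+2)_{b-a+1}\,(b+3)_{a-1}}\prod_{i=1}^{a}\frac{(c+i)_{b-a+1}\,(2c+b-a+1+i)_{i-1}}{(i)_{b-a+1}\,(b-a+1+i)_{i-1}} . \] Moreover, for every non-negative integers $b,c$, $M(S_{b+1,b,c})=M(S_{b,b,c})$.
   Context: Work in the triangular lattice of unit equilateral triangles whose lattice lines are the horizontal lines $y=kh$ ($k\in\mathbb Z$, $h=\sqrt3/2$) and the lines at $60^\circ$ and $120^\circ$ to them; the lattice points are $(i+k/2,\,kh)$ for $i,k\in\mathbb Z$. A region is a finite union of unit triangles; a lozenge is the union of two unit triangles sharing an edge; a lozenge tiling of a region is a covering of it by non-overlapping lozenges. $M(R)$ denotes the number of lozenge tilings of $R$. Pochhammer symbol: for $k\in\mathbb Z$, $(\alpha)_k=\alpha(\alpha+1)\cdots(\alpha+k-1)$ if $k>0$, $(\alpha)_0=1$, and $(\alpha)_k=1/\big((\alpha-1)(\alpha-2)\cdots(\alpha+k)\big)$ if $k<0$. Empty products equal $1$. The region $S_{a,b,c}$ (for non-negative integers $a,b,c$ with $a\le b+1$): let $H$ be the lattice hexagon with vertices $B=(0,0)$, $C=(c+1,0)$, $D=(c+1+b/2,\,bh)$, $E=(c+(b-a)/2,\,(a+b+2)h)$, $F=((b-a)/2,\,(a+b+2)h)$,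 $A=(-(a+1)/2,\,(a+1)h)$; its sides have lengths $|BC|=c+1$ (south), $|CD|=b$ (southeast), $|DE|=a+2$ (northeast), $|EF|=c$ (north), $|FA|=b+1$ (northwest), $|AB|=a+1$ (southwest). Let $Z$ be the zigzag lattice path starting at $B$ consisting of $2a+1$ unit steps alternating between $(-1/2,h)$ and $(1/2,h)$, starting and ending with $(-1/2,h)$; it ends at $(-1/2,(2a+1)h)$, a point of side $FA$. Remove from $H$ the part lying west of $Z$ (the "maximal staircase"), i.e. keep the region bounded by $B\to C\to D\to E\to F$, then along side $FA$ from $F$ down to $(-1/2,(2a+1)h)$, then back along $Z$ to $B$. Finally remove the upward-pointing unit triangle with vertices $(c+(b-1)/2,(b+1)h)$, $(c+(b+1)/2,(b+1)h)$, $(c+b/2,(b+2)h)$ (the unit triangle having an edge on the northeast side $DE$, second from the east corner $D$). The resulting region is $S_{a,b,c}$. *)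

theory Defs
  imports "HOL-Analysis.Analysis"
begin

definition lattice_height :: real where
  "lattice_height = sqrt 3 / 2"

definition lattice_point :: "int \<Rightarrow> int \<Rightarrow> real \<times> real" where
  "lattice_point i k = (of_int i + of_int k / 2, of_int k * lattice_height)"

text \<open>A unit triangle is represented by the set of its three vertices; the triangle as a
  subset of the plane is the convex hull of that set.\<close>

type_synonym triangle = "(real \<times> real) set"

definition up_triangle :: "int \<Rightarrow> int \<Rightarrow> triangle" where
  "up_triangle i k = {lattice_point i k, lattice_point (i + 1) k, lattice_point i (k + 1)}"

definition down_triangle :: "int \<Rightarrow> int \<Rightarrow> triangle" where
  "down_triangle i k =
     {lattice_point (i + 1) k, lattice_point i (k + 1), lattice_point (i + 1) (k + 1)}"

definition unit_triangles :: "triangle set" where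
  "unit_triangles = {t. \<exists>i k. t = up_triangle i k \<or> t = down_triangle i k}"

text \<open>A region is represented by the finite set of the unit triangles it is the union of, and a
  lozenge by the set of its two unit triangles. Having exactly two common vertices means
  sharing an edge. Covering without overlaps then means partitioning the set of triangles.\<close>

definition lozenges :: "triangle set set" where
  "lozenges =
     {{s, t} | s t. s \<in> unit_triangles \<and> t \<in> unit_triangles \<and> card (s \<inter> t) = 2}"

definition lozenge_tilings :: "triangle set \<Rightarrow> triangle set set set" where
  "lozenge_tilings R = {T. T \<subseteq> lozenges \<and> partition_on R T}"

definition num_tilings :: "triangle set \<Rightarrow> nat" where
  "num_tilings R = card (lozenge_tilings R)"

text \<open>The vertices are listed in the order $B, C, D, E, F, A$.\<close>

definition hexagon :: "nat \<Rightarrow> nat \<Rightarrow> nat \<Rightarrow> (real \<times> real) set" where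
  "hexagon a b c = convex hull
     {(0, 0),
      (real c + 1, 0),
      (real c + 1 + real b / 2, real b * lattice_height),
      (real c + (real b - real a) / 2, (real a + real b + 2) * lattice_height),
      ((real b - real a) / 2, (real a + real b + 2) * lattice_height),
      (- (real a + 1) / 2, (real a + 1) * lattice_height)}"

definition zigzag_vertex :: "nat \<Rightarrow> real \<times> real" where
  "zigzag_vertex n = (if even n then 0 else - 1 / 2, real n * lattice_height)"

definition zigzag :: "nat \<Rightarrow> (real \<times> real) set" where
  "zigzag a = (\<Union>n<2 * a + 1. closed_segment (zigzag_vertex n) (zigzag_vertex (Suc n)))"

text \<open>The inequality is not strict because the triangles are closed and may have an edge or a
  vertex on the zigzag. The condition fails for every triangle reaching above the end of the
  zigzag.\<close>

definition west_of_zigzag :: "nat \<Rightarrow> triangle \<Rightarrow> bool" where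
  "west_of_zigzag a t \<longleftrightarrow>
     (\<forall>p \<in> convex hull t. \<exists>q \<in> zigzag a. snd q = snd p \<and> fst p \<le> fst q)"

definition dent :: "nat \<Rightarrow> nat \<Rightarrow> triangle" where
  "dent b c =
     {(real c + (real b - 1) / 2, (real b + 1) * lattice_height),
      (real c + (real b + 1) / 2, (real b + 1) * lattice_height),
      (real c + real b / 2, (real b + 2) * lattice_height)}"

text \<open>This is the intended region only for \<open>a \<le> b + 1\<close>, when the zigzag stays in the hexagon and
  ends on its northwest side.\<close>

definition S_region :: "nat \<Rightarrow> nat \<Rightarrow> nat \<Rightarrow> triangle set" where
  "S_region a b c =
     {t \<in> unit_triangles. convex hull t \<subseteq> hexagon a b c \<and> \<not> west_of_zigzag a t} - {dent b c}"

text \<open>The library's \<^const>\<open>pochhammer\<close>, extended to negative indices by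
  $(x)_{-m} = 1 / ((x-1)(x-2)\cdots(x-m))$.\<close>

definition int_pochhammer :: "real \<Rightarrow> int \<Rightarrow> real" where
  "int_pochhammer x k =
     (if k \<ge> 0 then pochhammer x (nat k) else 1 / (\<Prod>j = 1..nat (- k). x - real j))"

end

theory Submission
  imports Defs "Jordan_Normal_Form.Determinant"
begin

text \<open>Follow the lozenges that have two sides on lattice lines \<open>i + k = s\<close>. They form
  non-intersecting lattice paths, one from every zigzag edge of direction $120^\circ$ to the edges of
  the northeast side other than that of the dent. Strip by strip, Pascal's rule and the multilinearity
  of the determinant show that the number of path families is the determinant of the matrix with
  entries $\binom{b+c+1-j}{y_i-2j}$, where \<open>y\<^sub>i\<close> runs through the heights of the end edges.

  Up to row factors, the columns of this matrix are polynomials in \<open>j\<close> that vanish at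
  \<open>j = - (c + 1)\<close>, once a multiple of $\prod_r (j-r)$, which is zero at all nodes, is subtracted from
  the first one. After division by the common factor \<open>j + c + 1\<close> the degrees are so small that the
  determinant is invariant under translation of \<open>j\<close>, and at the nodes $-c, -c+1, \ldots$ the matrix
  is triangular.\<close>

section \<open>Determinants\<close>

text \<open>Paths are never formalised, and no sign-reversing involution is needed. Going back over
  one strip, a path keeps its height or loses one, so increasing heights stay weakly increasing: two
  paths can meet but not cross, and no permutation sign arises. Multilinearity expands the
  determinant over all choices of steps. A choice in which paths meet has two equal rows, one that
  leaves the region has a zero row, and one that misses a zigzag edge has a zero column. The
  determinant thus discards exactly the choices that do not extend to tilings.

  The dent is the obstacle in the evaluation. Each column polynomial has degree
  \<open>a + 1\<close>, one too many for translation. The columns above the dent have the linear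
  factor whose removal cures this, but the column of height \<open>b\<close>, below the dent, lacks
  it. The price of the correction is that the diagonal entry of this column is a difference of two
  products; it yields $(2b-a+2)c+(b+1)(b+2)$, the one factor of the formula that does not split into
  linear ones.\<close>

definition dt :: "nat \<Rightarrow> (nat \<Rightarrow> nat \<Rightarrow> real) \<Rightarrow> real" where
  "dt n F = Determinant.det (Matrix.mat n n (\<lambda>(i, j). F i j))"

lemma dt_leibniz:
  "dt n F = (\<Sum>p | p permutes {0..<n}. signof p * (\<Prod>i = 0..<n. F i (p i)))"
  unfolding dt_def
  by (subst det_def'[of _ n]) (auto intro!: sum.cong prod.cong simp: permutes_in_image)

lemma dt_cong:
  assumes "\<And>i j. i < n \<Longrightarrow> j < n \<Longrightarrow> F i j = G i j"
  shows "dt n F = dt n G"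
  unfolding dt_def using assms by (intro arg_cong[where f = Determinant.det] eq_matI) auto

lemma dt_scale:
  "dt n (\<lambda>i j. r i * c j * F i j) = (\<Prod>i<n. r i) * (\<Prod>j<n. c j) * dt n F"
proof -
  have "(\<Prod>i = 0..<n. r i * c (p i) * F i (p i)) =
      (\<Prod>i<n. r i) * (\<Prod>j<n. c j) * (\<Prod>i = 0..<n. F i (p i))" if "p permutes {0..<n}" for p
    using prod.permute[OF that, of c] by (simp add: prod.distrib atLeast0LessThan comp_def)
  then show ?thesis
    by (simp add: dt_leibniz sum_distrib_left mult_ac)
qed

text \<open>Multilinearity in all rows at once. In the application \<open>X\<close> is the set of
  paths that cross a strip by a horizontal step.\<close>

lemma dt_add_rows:
  "dt n (\<lambda>i j. A i j + B i j) = (\<Sum>X \<in> Pow {0..<n}. dt n (\<lambda>i j. if i \<in> X then A i j else B i j))"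
proof -
  have *: "(\<Prod>i = 0..<n. A i (p i) + B i (p i)) =
      (\<Sum>X \<in> Pow {0..<n}. \<Prod>i = 0..<n. if i \<in> X then A i (p i) else B i (p i))" for p
  proof -
    have "(\<Prod>x\<in>X. A x (p x)) * (\<Prod>x\<in>{0..<n} - X. B x (p x)) =
        (\<Prod>i = 0..<n. if i \<in> X then A i (p i) else B i (p i))" if "X \<in> Pow {0..<n}" for X
    proof -
      have "{0..<n} \<inter> {i. i \<in> X} = X" "{0..<n} \<inter> - {i. i \<in> X} = {0..<n} - X"
        using that by auto
      then show ?thesis
        by (subst prod.If_cases) simp_all
    qed
    then show ?thesis by (simp add: prod_add)
  qed
  show ?thesis
    unfolding dt_leibniz * sum_distrib_left
    by (rule sum.swap)
qed

lemma dt_transpose: "dt n (\<lambda>i j. F j i) = dt n F"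
proof -
  let ?A = "Matrix.mat n n (\<lambda>(i, j). F i j)"
  have "Matrix.mat n n (\<lambda>(i, j). F j i) = transpose_mat ?A"
    by (intro eq_matI) auto
  then show ?thesis
    unfolding dt_def by (simp add: det_transpose[of ?A n])
qed

lemma dt_identical_rows:
  assumes "i < n" "k < n" "i \<noteq> k" "\<And>j. j < n \<Longrightarrow> F i j = F k j"
  shows "dt n F = 0"
  unfolding dt_def
  by (rule det_identical_rows[of _ n i k]) (use assms in \<open>auto intro!: eq_vecI\<close>)

lemma dt_zero_row:
  assumes "i < n" "\<And>j. j < n \<Longrightarrow> F i j = 0"
  shows "dt n F = 0"
  unfolding dt_leibniz
proof (rule sum.neutral, safe)
  fix p assume "p permutes {0..<n}"
  then have "p i < n" using assms(1) by (simp add: permutes_in_image[of p "{0..<n}" i, simplified])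
  then show "signof p * (\<Prod>i = 0..<n. F i (p i)) = 0"
    using assms by (auto intro!: prod_zero bexI[of _ i])
qed

lemma dt_zero_column:
  assumes "j < n" "\<And>i. i < n \<Longrightarrow> F i j = 0"
  shows "dt n F = 0"
  using dt_zero_row[of j n "\<lambda>i j. F j i"] assms dt_transpose[of n F] by metis

text \<open>Laplace expansion along the last column. Since entries are given by a function on all
  index pairs, \<open>F\<close> stays the same when the size drops; this removes a path that
  consists of its entry edge only.\<close>

lemma dt_last_column:
  assumes "\<And>i. i < n \<Longrightarrow> F i n = 0" "F n n = 1"
  shows "dt (Suc n) F = dt n F"
proof -
  let ?A = "Matrix.mat (Suc n) (Suc n) (\<lambda>(i, j). F i j)"
  have "dt (Suc n) F = (\<Sum>i<Suc n. ?A $$ (i, n) * cofactor ?A i n)"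
    unfolding dt_def by (rule laplace_expansion_column) auto
  also have "\<dots> = cofactor ?A n n"
    using assms by simp
  also have "mat_delete ?A n n = Matrix.mat n n (\<lambda>(i, j). F i j)"
    by (intro eq_matI) (auto simp: mat_delete_def)
  then have "cofactor ?A n n = dt n F"
    by (simp add: cofactor_def dt_def)
  finally show ?thesis .
qed

lemma dt_upper_triangular:
  assumes "\<And>i j. j < i \<Longrightarrow> i < n \<Longrightarrow> F i j = 0"
  shows "dt n F = (\<Prod>i<n. F i i)"
proof -
  have "dt n F = prod_list (diag_mat (Matrix.mat n n (\<lambda>(i, j). F i j)))"
    unfolding dt_def using assms by (intro det_upper_triangular[of _ n]) auto
  then show ?thesis
    by (simp add: prod_list_diag_prod atLeast0LessThan)
qed

lemma dt_lower_triangular: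
  assumes "\<And>i j. i < j \<Longrightarrow> j < n \<Longrightarrow> F i j = 0"
  shows "dt n F = (\<Prod>i<n. F i i)"
proof -
  have "dt n F = prod_list (diag_mat (Matrix.mat n n (\<lambda>(i, j). F i j)))"
    unfolding dt_def using assms by (intro det_lower_triangular[of n]) auto
  then show ?thesis
    by (simp add: prod_list_diag_prod atLeast0LessThan)
qed

lemma dt_mult:
  "dt n F * dt n G = dt n (\<lambda>i j. \<Sum>k<n. F i k * G k j)"
proof -
  let ?F = "Matrix.mat n n (\<lambda>(i, j). F i j)" and ?G = "Matrix.mat n n (\<lambda>(i, j). G i j)"
  have "?F * ?G = Matrix.mat n n (\<lambda>(i, j). \<Sum>k<n. F i k * G k j)"
    by (intro eq_matI) (auto simp: scalar_prod_def atLeast0LessThan)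
  then show ?thesis
    unfolding dt_def by (subst det_mult[of ?F n ?G, symmetric]) auto
qed

text \<open>The matrix factors as Vandermonde matrix times translation matrix times coefficient matrix,
  and the translation matrix is unitriangular.\<close>
lemma dt_poly_shift:
  fixes f :: "nat \<Rightarrow> real poly" and x :: "nat \<Rightarrow> real"
  assumes deg: "\<And>j. j < n \<Longrightarrow> degree (f j) < n"
  shows "dt n (\<lambda>i j. poly (f j) (x i + h)) = dt n (\<lambda>i j. poly (f j) (x i))"
proof -
  define V where "V = (\<lambda>i k. x i ^ k)"
  define C where "C = (\<lambda>l j. coeff (f j) l)"
  define P where "P = (\<lambda>k l. coeff ([:h, 1:] ^ l) k)"
  have degp: "degree ([:h, 1:] ^ l) = l" for l
    by (simp add: degree_power_eq)
  have poly_eq: "poly p y = (\<Sum>k<n. coeff p k * y ^ k)" if "degree p < n" for p :: "real poly" and y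
    unfolding poly_altdef using that
    by (intro sum.mono_neutral_left) (auto simp: coeff_eq_0)
  have "dt n (\<lambda>i j. poly (f j) (x i)) = dt n V * dt n C"
    unfolding dt_mult V_def C_def by (rule dt_cong) (auto simp: poly_eq deg mult_ac)
  moreover have "dt n (\<lambda>i j. poly (f j) (x i + h)) = dt n V * (dt n P * dt n C)"
    unfolding dt_mult
  proof (rule dt_cong)
    fix i j assume ij: "i < n" "j < n"
    have "poly (f j) (x i + h) = (\<Sum>l<n. coeff (f j) l * poly ([:h, 1:] ^ l) (x i))"
      using ij by (simp add: poly_eq deg poly_power add.commute)
    also have "\<dots> = (\<Sum>l<n. coeff (f j) l * (\<Sum>k<n. P k l * x i ^ k))"
      by (intro sum.cong refl) (subst poly_eq, auto simp: degp P_def)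
    also have "\<dots> = (\<Sum>l<n. \<Sum>k<n. V i k * (P k l * C l j))"
      by (simp add: sum_distrib_left C_def V_def mult_ac)
    also have "\<dots> = (\<Sum>k<n. V i k * (\<Sum>l<n. P k l * C l j))"
      by (subst sum.swap) (simp add: sum_distrib_left)
    finally show "poly (f j) (x i + h) = (\<Sum>k<n. V i k * (\<Sum>l<n. P k l * C l j))" .
  qed
  moreover have "dt n P = 1"
  proof -
    have "P i i = 1" for i
      using degp[of i] lead_coeff_power[of "[:h, 1:]" i] by (simp add: P_def)
    moreover have "P i j = 0" if "j < i" for i j
      using that by (simp add: P_def coeff_eq_0 degp)
    ultimately show ?thesis by (subst dt_upper_triangular) auto
  qed
  ultimately show ?thesis by simp
qed

section \<open>Evaluation of the binomial determinant\<close>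

text \<open>The lower index is an integer because \<open>y i - 2 * int j\<close> can be negative;
  the value 0 then says that no path leads from the \<open>j\<close>-th zigzag edge to an end that
  low.\<close>

definition binom :: "nat \<Rightarrow> int \<Rightarrow> nat" where
  "binom n k = (if k < 0 then 0 else n choose nat k)"

section \<open>Factorials, falling factorials and Pochhammer symbols\<close>

lemma falling_factorial_fact:
  "u \<le> K \<Longrightarrow> (\<Prod>r<u. real K - real r) * fact (K - u) = fact K"
proof (induction u)
  case (Suc u)
  then have "fact (K - u) = (real K - real u) * fact (K - Suc u)"
    by (metis Suc_diff_Suc Suc_le_lessD fact_Suc of_nat_diff less_imp_le of_nat_fact of_nat_mult)
  with Suc show ?case by (simp add: mult_ac)
qed simp

lemma falling_factorial_eq_0: "K < u \<Longrightarrow> (\<Prod>r<u. real K - real r) = 0"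
  by (rule prod_zero[OF finite_lessThan]) auto

text \<open>The two products are \<open>K! / (K - u)!\<close> and \<open>L! / (L - v)!\<close>.
  Outside the range \<open>u \<le> K\<close>, \<open>v \<le> L\<close> one of them contains the
  factor 0, in agreement with the binomial coefficient, so that zero entries of the matrix need no
  separate treatment.\<close>

lemma binom_factor:
  assumes "int N = int K - int u + (int L - int v)"
  shows "real (binom N (int K - int u)) =
    fact N / (fact K * fact L) * ((\<Prod>r<u. real K - real r) * (\<Prod>r<v. real L - real r))"
proof (cases "u \<le> K \<and> v \<le> L")
  case True
  then have N: "N = (K - u) + (L - v)" "N - (K - u) = L - v" and K: "nat (int K - int u) = K - u"
    using assms by auto
  have "real (binom N (int K - int u)) = fact N / (fact (K - u) * fact (L - v))"
    using True unfolding binom_def K N(2)[symmetric] by (subst binomial_fact[symmetric]) (auto simp: N(1))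
  moreover have "fact K = (\<Prod>r<u. real K - real r) * fact (K - u)"
    "fact L = (\<Prod>r<v. real L - real r) * fact (L - v)"
    using True by (simp_all add: falling_factorial_fact)
  moreover have "fact K \<noteq> (0 :: real)" "fact L \<noteq> (0 :: real)" by simp_all
  ultimately show ?thesis by (simp add: field_simps)
next
  case False
  then have "K < u \<or> L < v" by auto
  moreover from this have "binom N (int K - int u) = 0"
    using assms by (auto simp: binom_def intro!: binomial_eq_0)
  ultimately show ?thesis by (auto simp: falling_factorial_eq_0)
qed

lemma degree_prod_linear_le: "degree (\<Prod>i\<in>A. [:u i, v i :: real:]) \<le> card A"
proof (cases "finite A")
  case True
  have "degree (\<Prod>i\<in>A. [:u i, v i:]) \<le> (\<Sum>i\<in>A. (degree \<circ> (\<lambda>i. [:u i, v i:])) i)"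
    by (rule order_trans[OF degree_prod_sum_le[OF True]]) simp
  also have "\<dots> \<le> (\<Sum>i\<in>A. 1)" by (rule sum_mono) simp
  finally show ?thesis by simp
qed simp

lemma pochhammer_Suc_fact: "pochhammer (real (Suc n)) k = fact (n + k) / fact n"
proof (induction k)
  case (Suc k)
  have "pochhammer (real (Suc n)) (Suc k) = fact (n + k) / fact n * (real (Suc n) + real k)"
    unfolding pochhammer_Suc Suc.IH ..
  also have "real (Suc n) + real k = real (Suc (n + k))" by simp
  also have "fact (n + k) / fact n * real (Suc (n + k)) = fact (n + Suc k) / fact n"
    by simp
  finally show ?case .
qed simp

lemma pochhammer_eq_falling: "pochhammer (x :: real) k = (\<Prod>r<k. x + real k - 1 - real r)"
  unfolding pochhammer_prod atLeast0LessThan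
  by (subst prod.nat_diff_reindex[symmetric]) (auto intro!: prod.cong simp: of_nat_diff algebra_simps)

lemma int_pochhammer_of_nat: "int_pochhammer x (int k) = pochhammer x k"
  by (simp add: int_pochhammer_def)

text \<open>Handles the index \<open>int a - 1\<close> of the formula uniformly, including the value
  -1 at \<open>a = 0\<close>.\<close>

lemma int_pochhammer_pred: "x \<noteq> 1 \<Longrightarrow> int_pochhammer x (int k - 1) = pochhammer (x - 1) k / (x - 1)"
  by (cases k) (simp_all add: int_pochhammer_def pochhammer_rec)

text \<open>The factors of Proctor's product formula for the region without dent.\<close>
definition proctor_factor :: "nat \<Rightarrow> nat \<Rightarrow> nat \<Rightarrow> real" where
  "proctor_factor d c j =
     fact (d + c + 1 + j) * fact j * pochhammer (real (d + 2 * c + 2 + j)) j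
       / (fact (d + 1 + 2 * j) * fact (c + j))"

text \<open>Here \<open>d\<close> stands for \<open>b - a\<close>, and the ends index the columns,
  so that a column is a function of the start \<open>j\<close>.\<close>

lemma dt_binom_eval:
  "dt (Suc a) (\<lambda>j i. real (binom (a + d + c + 1 - j)
       (int (a + d) + (if i = 0 then 0 else int i + 1) - 2 * int j))) =
   (real a + 1) * (real (2 * d + a + 2) * real c + real (a + d + 1) * real (a + d + 2))
     / (real (a + d + 2 * c + 2) * real (c + a + 1)) * (\<Prod>j\<le>a. proctor_factor d c j)"
  (is "dt _ ?B = _")
proof -
  define m where "m = real c + 1"
  define P where "P = (\<lambda>u. \<Prod>r<u. [:real (2 * a + d + 1) - real r, -2:])"
  define w where "w = (\<Prod>r<Suc a. [:- real r, 1:])"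
  define \<kappa> where "\<kappa> = poly (P (Suc a)) (- m) / poly w (- m)"
  define R where "R = (\<lambda>j. fact (a + d + c + 1 - j) / (fact (2 * a + d + 1 - 2 * j) * fact (c + 1 + j)) :: real)"
  have w_nz: "poly w (- m) \<noteq> 0"
    by (auto simp: w_def m_def poly_prod)
  have "poly (P (Suc a) - Polynomial.smult \<kappa> w) (- m) = 0"
    using w_nz by (simp add: \<kappa>_def)
  then have "[:m, 1:] dvd P (Suc a) - Polynomial.smult \<kappa> w"
    by (simp only: poly_eq_0_iff_dvd minus_minus)
  then obtain f0 where f0: "P (Suc a) - Polynomial.smult \<kappa> w = [:m, 1:] * f0"
    unfolding dvd_def by blast
  define h where "h = (\<lambda>i. if i = 0 then f0 else P (a - i) * (\<Prod>r<i. [:m - 1 - real r, 1:]))"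
  have degP: "degree (P u) \<le> u" for u
    unfolding P_def using degree_prod_linear_le[of _ _ "{..<u}"] by simp
  have degw: "degree w \<le> Suc a"
    unfolding w_def using degree_prod_linear_le[of _ _ "{..<Suc a}"] by (simp del: prod.lessThan_Suc)
  have deg: "degree (h i) < Suc a" if "i < Suc a" for i
  proof (cases "i = 0")
    case True
    \<comment> \<open>Only the degree of the product is bounded directly; exact division by a linear
      factor lowers it by one, to at most \<open>a\<close>.\<close>
    have "degree ([:m, 1:] * f0) \<le> Suc a"
      unfolding f0[symmetric] by (intro degree_diff_le degP order_trans[OF degree_smult_le] degw)
    moreover have "degree ([:m, 1:] * f0) = Suc (degree f0)" if "f0 \<noteq> 0"
      using that by (subst degree_mult_eq) auto
    ultimately show ?thesis using True by (cases "f0 = 0") (auto simp: h_def)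
  next
    case False
    have "degree (h i) \<le> (a - i) + card {..<i}"
      using False unfolding h_def
      by (auto intro!: order_trans[OF degree_mult_le] add_mono degP degree_prod_linear_le
          simp del: card_lessThan)
    then show ?thesis using that by simp
  qed
  have entry: "?B j i = R j * (m + real j) * poly (h i) (real j)" if "j < Suc a" "i < Suc a" for i j
  proof -
    \<comment> \<open>The end heights are \<open>b + t\<close>; the dent skips \<open>t = 1\<close>.
      Taking the lower index belonging to \<open>t = a + 1\<close> and the complementary index
      belonging to \<open>t = 0\<close> as reference values makes \<open>R j\<close> independent of
      the column and turns the rest of the entry into falling factorials, which are polynomials in
      \<open>j\<close>.\<close>
    define t where "t = (if i = 0 then 0 else Suc i)"
    have "?B j i = real (binom (a + d + c + 1 - j) (int (2 * a + d + 1 - 2 * j) - int (Suc a - t)))"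
      using that by (auto simp: t_def intro!: arg_cong[where f = "binom _"])
    also have "\<dots> = R j * ((\<Prod>r<Suc a - t. real (2 * a + d + 1 - 2 * j) - real r) *
        (\<Prod>r<t. real (c + 1 + j) - real r))"
      unfolding R_def using that by (intro binom_factor) (auto simp: t_def)
    also have "(\<Prod>r<Suc a - t. real (2 * a + d + 1 - 2 * j) - real r) = poly (P (Suc a - t)) (real j)"
      using that by (auto simp: P_def poly_prod of_nat_diff intro!: prod.cong)
    also have "poly (P (Suc a - t)) (real j) * (\<Prod>r<t. real (c + 1 + j) - real r) =
        (m + real j) * poly (h i) (real j)"
    proof (cases "i = 0")
      case True
      have "poly w (real j) = 0"
        using that by (auto simp: w_def poly_prod)
      then have "poly (P (Suc a)) (real j) = poly ([:m, 1:] * f0) (real j)"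
        unfolding f0[symmetric] by simp
      then show ?thesis using True by (simp add: t_def h_def algebra_simps)
    next
      case False
      have "(\<Prod>r<Suc i. real (c + 1 + j) - real r) = (m + real j) * (\<Prod>r<i. m - 1 - real r + real j)"
        by (subst prod.lessThan_Suc_shift) (simp add: m_def algebra_simps)
      then show ?thesis using False by (simp add: t_def h_def poly_prod mult_ac)
    qed
    finally show ?thesis by (simp add: mult_ac)
  qed
  have "dt (Suc a) ?B = dt (Suc a) (\<lambda>j i. (R j * (m + real j)) * 1 * poly (h i) (real j))"
    by (rule dt_cong) (simp only: entry mult_1_right)
  also have "\<dots> = (\<Prod>j<Suc a. R j * (m + real j)) * dt (Suc a) (\<lambda>j i. poly (h i) (real j))"
    by (subst dt_scale) simp
  \<comment> \<open>Since \<open>1 - m\<close> is \<open>- c\<close>, the second product in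
    \<open>h i\<close> becomes the falling factorial of \<open>j\<close> of length \<open>i\<close>
    at the new nodes. It vanishes for \<open>j < i\<close> and is \<open>fact i\<close> on the
    diagonal.\<close>
  also have "dt (Suc a) (\<lambda>j i. poly (h i) (real j)) = dt (Suc a) (\<lambda>j i. poly (h i) (real j + (1 - m)))"
    by (rule dt_poly_shift[symmetric]) (rule deg)
  also have "\<dots> = (\<Prod>i<Suc a. poly (h i) (real i + (1 - m)))"
  proof (rule dt_lower_triangular)
    fix j i assume "j < i" "i < Suc a"
    then show "poly (h i) (real j + (1 - m)) = 0"
      by (auto simp: h_def poly_prod)
  qed
  also have "\<dots> = poly f0 (1 - m) * (\<Prod>i<a. fact (Suc i) * pochhammer (real (d + 2 * c + 2 + (a - Suc i))) (a - Suc i))"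
    unfolding prod.lessThan_Suc_shift
  proof (intro arg_cong2[where f = "(*)"] prod.cong refl)
    fix i assume "i \<in> {..<a}"
    then have i: "i < a" by simp
    have "poly (\<Prod>r<Suc i. [:m - 1 - real r, 1:]) (real (Suc i) + (1 - m)) = (\<Prod>r<Suc i. real (Suc i) - real r)"
      by (simp add: poly_prod algebra_simps del: prod.lessThan_Suc)
    also have "\<dots> = fact (Suc i)"
      using falling_factorial_fact[of "Suc i" "Suc i"] by (simp del: prod.lessThan_Suc)
    moreover have "poly (P (a - Suc i)) (real (Suc i) + (1 - m)) =
        pochhammer (real (d + 2 * c + 2 + (a - Suc i))) (a - Suc i)"
      unfolding pochhammer_eq_falling P_def poly_prod using i
      by (auto intro!: prod.cong simp: m_def of_nat_diff algebra_simps)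
    ultimately show "poly (h (Suc i)) (real (Suc i) + (1 - m)) =
        fact (Suc i) * pochhammer (real (d + 2 * c + 2 + (a - Suc i))) (a - Suc i)"
      by (simp add: h_def mult_ac del: prod.lessThan_Suc)
  qed (simp add: h_def)
  finally have D: "dt (Suc a) ?B = (\<Prod>j<Suc a. R j * (m + real j)) * (poly f0 (1 - m) *
      (\<Prod>i<a. fact (Suc i) * pochhammer (real (d + 2 * c + 2 + (a - Suc i))) (a - Suc i)))" .

  define Q where "Q = pochhammer (real (a + d + 2 * c + 2)) a"
  define X where "X = real (2 * d + a + 2) * real c + real (a + d + 1) * real (a + d + 2)"
  \<comment> \<open>The factor \<open>[:m, 1:]\<close> takes the value 1 at \<open>1 - m\<close>, so
    \<open>f0\<close> can be evaluated there without performing the division.\<close>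
  have "poly f0 (1 - m) = poly ([:m, 1:] * f0) (1 - m)" by (simp add: algebra_simps)
  also have "\<dots> = poly (P (Suc a)) (1 - m) - \<kappa> * poly w (1 - m)"
    unfolding f0[symmetric] by simp
  also have "poly (P (Suc a)) (1 - m) = pochhammer (real (a + d + 2 * c + 1)) (Suc a)"
    unfolding pochhammer_eq_falling P_def poly_prod
    by (auto intro!: prod.cong simp: m_def algebra_simps simp del: prod.lessThan_Suc)
  also have "\<dots> = real (a + d + 2 * c + 1) * Q"
    by (simp add: pochhammer_rec Q_def add_ac)
  also have "\<kappa> * poly w (1 - m) =
     Q * (real (2 * a + d + 2 * c + 2) * real (2 * a + d + 2 * c + 3)) / real (a + d + 2 * c + 2) * (real c / real (c + a + 1))"
  proof -
    have "poly (P (Suc a)) (- m) = pochhammer (real (a + d + 2 * c + 3)) (Suc a)"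
      unfolding pochhammer_eq_falling P_def poly_prod
      by (auto intro!: prod.cong simp: m_def algebra_simps simp del: prod.lessThan_Suc)
    moreover have "real (a + d + 2 * c + 2) * pochhammer (real (a + d + 2 * c + 3)) (Suc a) =
        pochhammer (real (a + d + 2 * c + 2)) (Suc (Suc a))"
      by (simp add: pochhammer_rec[of _ "Suc a"] add_ac)
    moreover have "\<dots> = Q * (real (2 * a + d + 2 * c + 2) * real (2 * a + d + 2 * c + 3))"
      by (simp add: pochhammer_Suc Q_def algebra_simps)
    ultimately have "poly (P (Suc a)) (- m) =
        Q * (real (2 * a + d + 2 * c + 2) * real (2 * a + d + 2 * c + 3)) / real (a + d + 2 * c + 2)"
      by (simp add: field_simps)
    moreover have "poly w (1 - m) / poly w (- m) = real c / real (c + a + 1)"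
    proof -
      have w: "poly w (- x) = (- 1) ^ Suc a * pochhammer x (Suc a)" for x
      proof -
        have "poly w (- x) = (\<Prod>r<Suc a. (- 1) * (x + real r))"
          unfolding w_def poly_prod by (intro prod.cong) auto
        also have "\<dots> = (- 1) ^ Suc a * pochhammer x (Suc a)"
          unfolding prod.distrib pochhammer_prod atLeast0LessThan by simp
        finally show ?thesis .
      qed
      have "pochhammer (real c) (Suc a) * real (c + a + 1) = real c * pochhammer m (Suc a)"
        using pochhammer_rec[of "real c" "Suc a"] pochhammer_Suc[of "real c" "Suc a"]
        by (simp add: m_def algebra_simps)
      moreover have "pochhammer m (Suc a) \<noteq> 0"
        by (auto simp: m_def pochhammer_eq_0_iff)
      ultimately show ?thesis
        using w[of m] w[of "real c"] by (simp add: m_def field_simps del: power_Suc)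
    qed
    moreover have "\<kappa> * poly w (1 - m) = poly (P (Suc a)) (- m) * (poly w (1 - m) / poly w (- m))"
      by (simp add: \<kappa>_def)
    ultimately show ?thesis by (simp only:)
  qed
  \<comment> \<open>Both terms contain \<open>Q\<close>; what remains combines to the bracket
    \<open>X\<close> of the formula over two linear factors.\<close>
  also have "real (a + d + 2 * c + 1) * Q - Q * (real (2 * a + d + 2 * c + 2) * real (2 * a + d + 2 * c + 3))
      / real (a + d + 2 * c + 2) * (real c / real (c + a + 1)) =
      (real a + 1) * X / (real (a + d + 2 * c + 2) * real (c + a + 1)) * Q"
    by (simp add: X_def divide_simps) (simp add: algebra_simps)
  finally have f0_val: "poly f0 (1 - m) = (real a + 1) * X / (real (a + d + 2 * c + 2) * real (c + a + 1)) * Q" .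

  \<comment> \<open>\<open>Q\<close> is precisely the factor that column 0 would contribute to the
    pattern of the other columns, so it completes the product to all
    \<open>j \<le> a\<close>.\<close>
  have "(\<Prod>j\<le>a. fact j * pochhammer (real (d + 2 * c + 2 + (a - j))) (a - j)) =
    Q * (\<Prod>i<a. fact (Suc i) * pochhammer (real (d + 2 * c + 2 + (a - Suc i))) (a - Suc i))"
    unfolding lessThan_Suc_atMost[symmetric] prod.lessThan_Suc_shift by (simp add: Q_def add_ac)
  then have D2: "dt (Suc a) ?B = (real a + 1) * X / (real (a + d + 2 * c + 2) * real (c + a + 1)) *
     ((\<Prod>j\<le>a. R j * (m + real j)) * (\<Prod>j\<le>a. fact j * pochhammer (real (d + 2 * c + 2 + (a - j))) (a - j)))"
    unfolding D f0_val lessThan_Suc_atMost by (simp add: mult_ac)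
  \<comment> \<open>\<open>G\<close> collects the factors that depend on \<open>a - j\<close>;
    reversing the order of the product removes the dependence on \<open>a\<close>.\<close>
  define G where "G = (\<lambda>v. fact (d + c + 1 + v) / fact (d + 1 + 2 * v) * pochhammer (real (d + 2 * c + 2 + v)) v)"
  have R_eq: "(\<Prod>j\<le>a. R j * (m + real j)) = (\<Prod>j\<le>a. fact (d + c + 1 + (a - j)) / fact (d + 1 + 2 * (a - j)) * (1 / fact (c + j)))"
  proof (intro prod.cong refl)
    fix j assume "j \<in> {..a}"
    then have "a + d + c + 1 - j = d + c + 1 + (a - j)" "2 * a + d + 1 - 2 * j = d + 1 + 2 * (a - j)"
      by auto
    moreover have "m + real j = real (c + 1 + j)" by (simp add: m_def)
    moreover have "fact (c + 1 + j) = real (c + 1 + j) * fact (c + j)" by simp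
    ultimately show "R j * (m + real j) = fact (d + c + 1 + (a - j)) / fact (d + 1 + 2 * (a - j)) * (1 / fact (c + j))"
      unfolding R_def by (simp only:) simp
  qed
  have "(\<Prod>j\<le>a. R j * (m + real j)) * (\<Prod>j\<le>a. fact j * pochhammer (real (d + 2 * c + 2 + (a - j))) (a - j)) =
      (\<Prod>j\<le>a. fact j / fact (c + j)) * (\<Prod>j\<le>a. G (a - j))"
    unfolding R_eq prod.distrib[symmetric] G_def by (simp add: mult_ac)
  moreover have "(\<Prod>j\<le>a. G (a - j)) = prod G {..a}"
    by (rule prod.reindex_bij_witness[of _ "\<lambda>j. a - j" "\<lambda>j. a - j"]) auto
  moreover have "(\<Prod>j\<le>a. fact j / fact (c + j)) * prod G {..a} = (\<Prod>j\<le>a. proctor_factor d c j)"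
    unfolding prod.distrib[symmetric] proctor_factor_def G_def by (intro prod.cong) (auto simp: field_simps)
  ultimately show ?thesis using D2 by (simp only: X_def)
qed

text \<open>The product over \<open>i\<close> consists of the Proctor factors of index below
  \<open>a\<close>; the one of index \<open>a\<close> is contained in the leading fraction.\<close>

lemma pochhammer_formula:
  assumes "b = a + d"
  shows "(int_pochhammer (real c + real a + 2) (int b - int a)
           * int_pochhammer (2 * real c + real b + 3) (int a - 1)
           * ((2 * real b - real a + 2) * real c + (real b + 1) * (real b + 2)))
        / (int_pochhammer (real a + 2) (int b - int a + 1)
           * int_pochhammer (real b + 3) (int a - 1))
        * (\<Prod>i = 1..a.
             (int_pochhammer (real c + real i) (int b - int a + 1)
                * int_pochhammer (2 * real c + real b - real a + 1 + real i) (int i - 1))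
             / (int_pochhammer (real i) (int b - int a + 1)
                * int_pochhammer (real b - real a + 1 + real i) (int i - 1))) =
   (real a + 1) * (real (2 * d + a + 2) * real c + real (a + d + 1) * real (a + d + 2))
     / (real (a + d + 2 * c + 2) * real (c + a + 1)) * (\<Prod>j\<le>a. proctor_factor d c j)"
   (is "?L * ?P = ?R")
proof -
  have b: "int b - int a = int d" "int b - int a + 1 = int (Suc d)" "real b = real a + real d"
    using assms by simp_all
  have "?P = (\<Prod>j<a. proctor_factor d c j)"
  proof (rule prod.reindex_bij_witness[of _ Suc "\<lambda>i. i - 1"])
    fix i assume "i \<in> {1..a}"
    then obtain j where i: "i = Suc j" by (cases i) auto
    have 1: "int_pochhammer (real c + real i) (int b - int a + 1) = fact (c + j + Suc d) / fact (c + j)"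
      unfolding b(2) int_pochhammer_of_nat using pochhammer_Suc_fact[of "c + j" "Suc d"] by (simp add: i add_ac)
    have 2: "int_pochhammer (real i) (int b - int a + 1) = fact (j + Suc d) / fact j"
      unfolding b(2) int_pochhammer_of_nat i by (rule pochhammer_Suc_fact)
    have 3: "int_pochhammer (real b - real a + 1 + real i) (int i - 1) = fact (d + 1 + 2 * j) / fact (j + Suc d)"
    proof -
      have "real b - real a + 1 + real i = real (Suc (j + Suc d))" "int i - 1 = int j"
        by (simp_all add: i b)
      moreover have "j + Suc d + j = d + 1 + 2 * j" by simp
      ultimately show ?thesis
        by (simp only: int_pochhammer_of_nat pochhammer_Suc_fact)
    qed
    have 4: "int_pochhammer (2 * real c + real b - real a + 1 + real i) (int i - 1) =
        pochhammer (real (d + 2 * c + 2 + j)) j"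
    proof -
      have "2 * real c + real b - real a + 1 + real i = real (d + 2 * c + 2 + j)" "int i - 1 = int j"
        by (simp_all add: i b)
      then show ?thesis by (simp only: int_pochhammer_of_nat)
    qed
    show "proctor_factor d c (i - 1) =
        int_pochhammer (real c + real i) (int b - int a + 1) *
        int_pochhammer (2 * real c + real b - real a + 1 + real i) (int i - 1) /
        (int_pochhammer (real i) (int b - int a + 1) *
         int_pochhammer (real b - real a + 1 + real i) (int i - 1))"
    proof -
      have j: "i - 1 = j" "d + c + 1 + j = c + j + Suc d" by (simp_all add: i)
      \<comment> \<open>\<open>B\<close> is \<open>fact (j + Suc d)\<close>, which occurs in both
        Pochhammer symbols of the denominator and cancels. The rule treats the factorials as
        opaque.\<close>
      have *: "A * f * p / (E * C) = (A / C * p) / ((B / f) * (E / B))"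
        if "B \<noteq> 0" "f \<noteq> 0" for A B C E f p :: real
        using that by (simp add: field_simps)
      show ?thesis
        unfolding 1 2 3 4 proctor_factor_def j by (rule *) (rule fact_nonzero)+
    qed
  qed auto
  moreover have "?L = (real a + 1) * (real (2 * d + a + 2) * real c + real (a + d + 1) * real (a + d + 2))
     / (real (a + d + 2 * c + 2) * real (c + a + 1)) * proctor_factor d c a"
  proof -
    have 1: "int_pochhammer (real c + real a + 2) (int b - int a) = fact (c + a + 1 + d) / fact (c + a + 1)"
      unfolding b(1) int_pochhammer_of_nat using pochhammer_Suc_fact[of "c + a + 1" d] by (simp add: add_ac)
    have 2: "int_pochhammer (2 * real c + real b + 3) (int a - 1) =
        pochhammer (real (d + 2 * c + 2 + a)) a / real (a + d + 2 * c + 2)"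
      by (subst int_pochhammer_pred) (simp_all add: b add_ac)
    have 3: "int_pochhammer (real a + 2) (int b - int a + 1) = fact (a + 1 + Suc d) / fact (a + 1)"
      unfolding b(2) int_pochhammer_of_nat using pochhammer_Suc_fact[of "a + 1" "Suc d"] by (simp add: add_ac)
    have 4: "int_pochhammer (real b + 3) (int a - 1) = fact (d + 1 + 2 * a) / fact (a + 1 + Suc d)"
    proof (subst int_pochhammer_pred)
      have "real b + 3 - 1 = real (Suc (a + d + 1))" "a + d + 1 + a = d + 1 + 2 * a"
        by (simp_all add: b)
      then have "pochhammer (real b + 3 - 1) a = fact (d + 1 + 2 * a) / fact (a + d + 1)"
        by (simp only: pochhammer_Suc_fact)
      then show "pochhammer (real b + 3 - 1) a / (real b + 3 - 1) = fact (d + 1 + 2 * a) / fact (a + 1 + Suc d)"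
        by (simp add: b field_simps)
    qed (simp add: b)
    have X: "(2 * real b - real a + 2) * real c + (real b + 1) * (real b + 2) =
        real (2 * d + a + 2) * real c + real (a + d + 1) * real (a + d + 2)"
      by (simp add: b algebra_simps)
    have f: "fact (a + 1) = (real a + 1) * fact a" "fact (c + a + 1) = real (c + a + 1) * fact (c + a)"
      by simp_all
    show ?thesis
      unfolding 1 2 3 4 X proctor_factor_def f by (simp add: divide_simps add_ac mult_ac)
  qed
  ultimately show ?thesis
    by (simp add: lessThan_Suc_atMost[symmetric])
qed

section \<open>Matching off part of a region\<close>

text \<open>A triangle has three vertices, so sharing exactly two already excludes
  \<open>s = t\<close>.\<close>

lemma lozengeD:
  assumes "l \<in> lozenges"
  obtains s t where "l = {s, t}" "s \<noteq> t"
proof -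
  obtain s t where st: "l = {s, t}" "s \<in> unit_triangles" "card (s \<inter> t) = 2"
    using assms by (auto simp: lozenges_def)
  have "s \<noteq> t"
  proof
    assume "s = t"
    moreover have "card s = 3"
      using st(2) by (auto simp: unit_triangles_def up_triangle_def down_triangle_def
          lattice_point_def lattice_height_def card_insert_if)
    ultimately show False using st(3) by simp
  qed
  then show thesis using that st(1) by blast
qed

lemma finite_lozenge_tilings: "finite R \<Longrightarrow> finite (lozenge_tilings R)"
  by (rule finite_subset[of _ "Pow (Pow R)"]) (auto simp: lozenge_tilings_def partition_on_def)

text \<open>Classify the tilings by the partner \<open>h v\<close> of every \<open>v \<in> V\<close>.\<close>
lemma num_tilings_remove:
  assumes fin: "finite R" and V: "V \<subseteq> R"
    and indep: "\<And>v w. v \<in> V \<Longrightarrow> w \<in> V \<Longrightarrow> {v, w} \<notin> lozenges"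
  defines "H \<equiv> {h \<in> V \<rightarrow>\<^sub>E R - V. inj_on h V \<and> (\<forall>v\<in>V. {v, h v} \<in> lozenges)}"
  shows "num_tilings R = (\<Sum>h\<in>H. num_tilings (R - V - h ` V))"
proof -
  define dom where "dom = (\<lambda>h. (\<lambda>v. {v, h v}) ` V)"
  define ext where "ext = (\<lambda>h T. dom h \<union> T)"
  have extI: "ext h T \<in> lozenge_tilings R"
    if h: "h \<in> H" and T: "T \<in> lozenge_tilings (R - V - h ` V)" for h T
  proof -
    have hV: "h ` V \<subseteq> R - V" "inj_on h V" using h by (auto simp: H_def)
    have 1: "partition_on (V \<union> h ` V) (dom h)"
      using hV by (auto simp: partition_on_def dom_def disjoint_def inj_on_def)
    have 2: "partition_on (R - V - h ` V) T"
      using T by (simp add: lozenge_tilings_def)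
    have "disjoint (dom h \<union> T)"
      using partition_onD2[OF 1] partition_onD2[OF 2]
      by (rule disjoint_union) (use partition_onD1[OF 1] partition_onD1[OF 2] in auto)
    then have "partition_on ((V \<union> h ` V) \<union> (R - V - h ` V)) (dom h \<union> T)"
      using 1 2 unfolding partition_on_def by auto
    moreover have "(V \<union> h ` V) \<union> (R - V - h ` V) = R"
      using V hV by auto
    ultimately show ?thesis
      using h T by (auto simp: lozenge_tilings_def ext_def dom_def H_def)
  qed
  \<comment> \<open>All lozenges of \<open>dom h\<close> meet \<open>V\<close> and none of
    \<open>T\<close> does, so \<open>T\<close> can be recovered from \<open>ext h T\<close>.\<close>
  have ext_rest: "{l \<in> ext h T. l \<inter> V = {}} = T" if T: "T \<in> lozenge_tilings (R - V - h ` V)" for h T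
    using T by (auto simp: ext_def dom_def lozenge_tilings_def partition_on_def)
  have extE: "T \<in> (\<Union>h\<in>H. ext h ` lozenge_tilings (R - V - h ` V))" if T: "T \<in> lozenge_tilings R" for T
  proof -
    have part: "partition_on R T" and loz: "T \<subseteq> lozenges" using T by (auto simp: lozenge_tilings_def)
    have same: "l = l'" if "l \<in> T" "l' \<in> T" "x \<in> l" "x \<in> l'" for l l' x
      using part that by (auto simp: partition_on_def disjoint_def)
    have "\<exists>w. w \<in> R - V \<and> {v, w} \<in> T" if v: "v \<in> V" for v
    proof -
      have "v \<in> \<Union>T" using part v V by (auto simp: partition_on_def)
      then obtain l where l: "l \<in> T" "v \<in> l" by blast
      obtain s t where "l = {s, t}" "s \<noteq> t" using lozengeD loz l(1) by blast
      then obtain w where w: "l = {v, w}" using l(2) by blast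
      have "w \<in> R" using part l(1) w by (auto simp: partition_on_def)
      moreover have "w \<notin> V" using indep[OF v, of w] loz l(1) w by auto
      ultimately show ?thesis using l(1) w by blast
    qed
    then obtain h0 where h0: "\<And>v. v \<in> V \<Longrightarrow> h0 v \<in> R - V \<and> {v, h0 v} \<in> T" by metis
    define h where "h = restrict h0 V"
    have h: "h v \<in> R - V" "{v, h v} \<in> T" if "v \<in> V" for v
      using h0[OF that] that by (simp_all add: h_def)
    have "inj_on h V"
    proof (rule inj_onI)
      fix v w assume vw: "v \<in> V" "w \<in> V" "h v = h w"
      then have "{v, h v} = {w, h w}" by (intro same[of _ _ "h v"] h) auto
      then show "v = w" using vw h by (auto simp: doubleton_eq_iff)
    qed
    then have hH: "h \<in> H"
      using h loz by (auto simp: H_def h_def)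
    define T' where "T' = T - dom h"
    have sub: "dom h \<subseteq> T" using h by (auto simp: dom_def)
    have "\<Union>T' = R - V - h ` V"
    proof -
      have avoid: "x \<in> R \<and> x \<notin> V \<and> x \<notin> h ` V" if "x \<in> l" "l \<in> T" "l \<notin> dom h" for x l
      proof -
        have "x \<in> R" using part that by (auto simp: partition_on_def)
        moreover have "x \<notin> V" using same[of l "{x, h x}" x] h(2)[of x] that by (auto simp: dom_def)
        moreover have "x \<noteq> h v" if v: "v \<in> V" for v
          using same[of l "{v, h v}" x] h(2)[OF v] v \<open>x \<in> l\<close> \<open>l \<in> T\<close> \<open>l \<notin> dom h\<close> by (auto simp: dom_def)
        ultimately show ?thesis by blast
      qed
      show ?thesis
      proof (rule equalityI; rule subsetI)
        fix x assume "x \<in> \<Union>T'"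
        then obtain l where "x \<in> l" "l \<in> T" "l \<notin> dom h" unfolding T'_def by blast
        from avoid[OF this] show "x \<in> R - V - h ` V" by blast
      next
        fix x assume x: "x \<in> R - V - h ` V"
        then obtain l where l: "l \<in> T" "x \<in> l" using partition_onD1[OF part] by blast
        moreover have "l \<notin> dom h" using x l(2) by (auto simp: dom_def)
        ultimately show "x \<in> \<Union>T'" unfolding T'_def by blast
      qed
    qed
    moreover have "{} \<notin> T'" "disjoint T'"
      using part by (auto simp: T'_def partition_on_def disjoint_def)
    ultimately have "T' \<in> lozenge_tilings (R - V - h ` V)"
      using loz by (auto simp: lozenge_tilings_def partition_on_def T'_def)
    moreover have "T = ext h T'" using sub by (auto simp: ext_def T'_def)
    ultimately show ?thesis using hH by blast
  qed
  have ext_inj: "h = h'" if "h \<in> H" "h' \<in> H" "T \<in> lozenge_tilings (R - V - h ` V)"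
    "T' \<in> lozenge_tilings (R - V - h' ` V)" "ext h T = ext h' T'" for h h' T T'
  proof (rule PiE_ext)
    show "h \<in> V \<rightarrow>\<^sub>E R - V" "h' \<in> V \<rightarrow>\<^sub>E R - V" using that by (auto simp: H_def)
    fix v assume v: "v \<in> V"
    have "disjoint (ext h T)"
      using extI[OF that(1,3)] by (simp add: lozenge_tilings_def partition_on_def)
    moreover have "{v, h v} \<in> ext h T" "{v, h' v} \<in> ext h T"
      using v that(5) by (auto simp: ext_def dom_def)
    ultimately have "{v, h v} = {v, h' v}"
      using disjointD[of "ext h T" "{v, h v}" "{v, h' v}"] by blast
    then show "h v = h' v" by (auto simp: doubleton_eq_iff)
  qed
  have "lozenge_tilings R = (\<Union>h\<in>H. ext h ` lozenge_tilings (R - V - h ` V))"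
    using extI extE by blast
  then have "num_tilings R = card (\<Union>h\<in>H. ext h ` lozenge_tilings (R - V - h ` V))"
    by (simp add: num_tilings_def)
  also have "\<dots> = (\<Sum>h\<in>H. card (ext h ` lozenge_tilings (R - V - h ` V)))"
  proof (rule card_UN_disjoint)
    have "finite (V \<rightarrow>\<^sub>E R - V)"
      using fin V by (intro finite_PiE) (auto intro: finite_subset)
    then show "finite H" by (simp add: H_def)
    show "\<forall>h\<in>H. finite (ext h ` lozenge_tilings (R - V - h ` V))"
      using fin by (auto intro: finite_lozenge_tilings)
    show "\<forall>h\<in>H. \<forall>h'\<in>H. h \<noteq> h' \<longrightarrow>
        ext h ` lozenge_tilings (R - V - h ` V) \<inter> ext h' ` lozenge_tilings (R - V - h' ` V) = {}"
    proof (intro ballI impI)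
      fix h h' assume hh: "h \<in> H" "h' \<in> H" "h \<noteq> h'"
      show "ext h ` lozenge_tilings (R - V - h ` V) \<inter> ext h' ` lozenge_tilings (R - V - h' ` V) = {}"
      proof (rule equals0I)
        fix X assume "X \<in> ext h ` lozenge_tilings (R - V - h ` V) \<inter> ext h' ` lozenge_tilings (R - V - h' ` V)"
        then obtain T T' where T: "T \<in> lozenge_tilings (R - V - h ` V)" "T' \<in> lozenge_tilings (R - V - h' ` V)"
          and eq: "X = ext h T" "X = ext h' T'" by blast
        have "ext h T = ext h' T'" using eq by simp
        then have "h = h'" by (rule ext_inj[OF hh(1,2) T])
        with hh(3) show False by contradiction
      qed
    qed
  qed
  also have "\<dots> = (\<Sum>h\<in>H. num_tilings (R - V - h ` V))"
    unfolding num_tilings_def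
  proof (intro sum.cong refl card_image inj_onI)
    fix h T T' assume T: "T \<in> lozenge_tilings (R - V - h ` V)" and T': "T' \<in> lozenge_tilings (R - V - h ` V)"
      and eq: "ext h T = ext h T'"
    have "T = {l \<in> ext h T. l \<inter> V = {}}" by (rule ext_rest[OF T, symmetric])
    also have "\<dots> = {l \<in> ext h T'. l \<inter> V = {}}" unfolding eq ..
    also have "\<dots> = T'" by (rule ext_rest[OF T'])
    finally show "T = T'" .
  qed
  finally show ?thesis .
qed

section \<open>Coordinates\<close>

lemma lattice_height_pos: "0 < lattice_height"
  by (simp add: lattice_height_def)

lemma lattice_point_eq_iff: "lattice_point i k = lattice_point i' k' \<longleftrightarrow> i = i' \<and> k = k'"
  using lattice_height_pos by (auto simp: lattice_point_def)

lemma up_triangle_Int_up: "card (up_triangle i k \<inter> up_triangle i' k') \<noteq> 2"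
proof
  assume "card (up_triangle i k \<inter> up_triangle i' k') = 2"
  then obtain x y where "x \<noteq> y" "x \<in> up_triangle i k \<inter> up_triangle i' k'" "y \<in> up_triangle i k \<inter> up_triangle i' k'"
    unfolding card_2_iff by blast
  moreover from this have "i = i' \<and> k = k'"
    by (auto simp: up_triangle_def lattice_point_eq_iff)
  moreover have "card (up_triangle i k) = 3"
    by (simp add: up_triangle_def lattice_point_eq_iff)
  ultimately show False
    using \<open>card _ = 2\<close> by simp
qed

lemma down_triangle_Int_down: "card (down_triangle i k \<inter> down_triangle i' k') \<noteq> 2"
proof
  assume "card (down_triangle i k \<inter> down_triangle i' k') = 2"
  then obtain x y where "x \<noteq> y" "x \<in> down_triangle i k \<inter> down_triangle i' k'" "y \<in> down_triangle i k \<inter> down_triangle i' k'"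
    unfolding card_2_iff by blast
  moreover from this have "i = i' \<and> k = k'"
    by (auto simp: down_triangle_def lattice_point_eq_iff)
  moreover have "card (down_triangle i k) = 3"
    by (simp add: down_triangle_def lattice_point_eq_iff)
  ultimately show False
    using \<open>card _ = 2\<close> by simp
qed

lemma up_triangle_Int_down:
  "card (up_triangle i k \<inter> down_triangle i' k') = 2 \<longleftrightarrow>
     (i', k') \<in> {(i, k), (i - 1, k), (i, k - 1)}"
proof
  assume "card (up_triangle i k \<inter> down_triangle i' k') = 2"
  then obtain x y where xy: "x \<noteq> y" "x \<in> up_triangle i k \<inter> down_triangle i' k'"
    "y \<in> up_triangle i k \<inter> down_triangle i' k'"
    unfolding card_2_iff by blast
  obtain x1 x2 where x: "x = lattice_point x1 x2"
    using xy(2) by (auto simp: up_triangle_def)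
  obtain y1 y2 where y: "y = lattice_point y1 y2"
    using xy(3) by (auto simp: up_triangle_def)
  have x12: "(x1, x2) \<in> {(i, k), (i + 1, k), (i, k + 1)} \<inter> {(i' + 1, k'), (i', k' + 1), (i' + 1, k' + 1)}"
    using xy(2) unfolding x up_triangle_def down_triangle_def by (simp add: lattice_point_eq_iff)
  have y12: "(y1, y2) \<in> {(i, k), (i + 1, k), (i, k + 1)} \<inter> {(i' + 1, k'), (i', k' + 1), (i' + 1, k' + 1)}"
    using xy(3) unfolding y up_triangle_def down_triangle_def by (simp add: lattice_point_eq_iff)
  define p q where "p = i' - i" and "q = k' - k"
  have ik: "i' = i + p" "k' = k + q" by (simp_all add: p_def q_def)
  \<comment> \<open>These are the offsets with at least one common vertex. For the last three the
    common vertex is unique, which contradicts \<open>x \<noteq> y\<close>.\<close>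
  have "(p, q) \<in> {(0, 0), (- 1, 0), (0, - 1), (- 1, - 1), (1, - 1), (- 1, 1)}"
    using x12 unfolding ik by (elim IntE insertE emptyE; simp)
  moreover have "(p, q) \<notin> {(- 1, - 1), (1, - 1), (- 1, 1)}"
  proof
    assume "(p, q) \<in> {(- 1, - 1), (1, - 1), (- 1, 1)}"
    then have "(x1, x2) = (y1, y2)"
      using x12 y12 unfolding ik by (elim IntE insertE emptyE; simp)
    then show False using xy(1) x y by simp
  qed
  ultimately show "(i', k') \<in> {(i, k), (i - 1, k), (i, k - 1)}"
    unfolding ik by auto
qed (auto simp: up_triangle_def down_triangle_def lattice_point_eq_iff Int_insert_left card_insert_if)

lemma lozenge_iff:
  "{s, t} \<in> lozenges \<longleftrightarrow> s \<in> unit_triangles \<and> t \<in> unit_triangles \<and> card (s \<inter> t) = 2"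
  by (auto simp: lozenges_def doubleton_eq_iff Int_commute)

text \<open>Strip \<open>s\<close> lies between the lattice lines \<open>i + k = s\<close> and \<open>i + k = s + 1\<close> of direction
  $120^\circ$; \<open>up_at (s - 1) k\<close> and \<open>down_at s k\<close> share an edge of the first of these lines.\<close>

definition up_at :: "int \<Rightarrow> int \<Rightarrow> triangle" where
  "up_at s k = up_triangle (s - k) k"

definition down_at :: "int \<Rightarrow> int \<Rightarrow> triangle" where
  "down_at s k = down_triangle (s - 1 - k) k"

lemma up_triangle_neq_down: "up_triangle i k \<noteq> down_triangle i' k'"
proof
  assume "up_triangle i k = down_triangle i' k'"
  then have "lattice_point i k \<in> down_triangle i' k'" "lattice_point (i + 1) k \<in> down_triangle i' k'"
    "lattice_point i (k + 1) \<in> down_triangle i' k'"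
    by (auto simp: up_triangle_def)
  then show False
    by (auto simp: down_triangle_def lattice_point_eq_iff)
qed

lemma up_triangle_eq_iff: "up_triangle i k = up_triangle i' k' \<longleftrightarrow> i = i' \<and> k = k'"
proof
  assume "up_triangle i k = up_triangle i' k'"
  then have "lattice_point i k \<in> up_triangle i' k'" "lattice_point i' k' \<in> up_triangle i k"
    by (auto simp: up_triangle_def)
  then show "i = i' \<and> k = k'"
    by (auto simp: up_triangle_def lattice_point_eq_iff)
qed auto

lemma down_triangle_eq_iff: "down_triangle i k = down_triangle i' k' \<longleftrightarrow> i = i' \<and> k = k'"
proof
  assume "down_triangle i k = down_triangle i' k'"
  then have "lattice_point (i + 1) (k + 1) \<in> down_triangle i' k'" "lattice_point (i' + 1) (k' + 1) \<in> down_triangle i k"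
    by (auto simp: down_triangle_def)
  then show "i = i' \<and> k = k'"
    by (auto simp: down_triangle_def lattice_point_eq_iff)
qed auto

lemma up_at_eq_iff [simp]: "up_at s k = up_at s' k' \<longleftrightarrow> s = s' \<and> k = k'"
  by (auto simp: up_at_def up_triangle_eq_iff)

lemma down_at_eq_iff [simp]: "down_at s k = down_at s' k' \<longleftrightarrow> s = s' \<and> k = k'"
  by (auto simp: down_at_def down_triangle_eq_iff)

lemma up_at_neq_down_at [simp]: "up_at s k \<noteq> down_at s' k'" "down_at s' k' \<noteq> up_at s k"
  by (simp_all add: up_at_def down_at_def up_triangle_neq_down up_triangle_neq_down[symmetric])

lemma unit_triangles_eq: "unit_triangles = {t. \<exists>s k. t = up_at s k \<or> t = down_at s k}"
proof -
  have "up_triangle i k = up_at (i + k) k" "down_triangle i k = down_at (i + k + 1) k" for i k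
    by (simp_all add: up_at_def down_at_def)
  then show ?thesis
    unfolding unit_triangles_def by (metis up_at_def down_at_def)
qed

lemma lozenge_up_at_iff:
  "{up_at s k, t} \<in> lozenges \<longleftrightarrow> t = down_at s k \<or> t = down_at s (k - 1) \<or> t = down_at (s + 1) k"
proof -
  have "card (up_at s k \<inter> down_at s' k') = 2 \<longleftrightarrow> (s', k') \<in> {(s, k), (s, k - 1), (s + 1, k)}" for s' k'
    unfolding up_at_def down_at_def up_triangle_Int_down by auto
  moreover have "card (up_at s k \<inter> up_at s' k') \<noteq> 2" for s' k'
    unfolding up_at_def by (rule up_triangle_Int_up)
  ultimately show ?thesis
    by (auto simp: lozenge_iff unit_triangles_eq)
qed

lemma lozenge_down_at_iff:
  "{down_at s k, t} \<in> lozenges \<longleftrightarrow> t = up_at s k \<or> t = up_at s (k + 1) \<or> t = up_at (s - 1) k"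
proof -
  have "card (down_at s k \<inter> up_at s' k') = 2 \<longleftrightarrow> (s', k') \<in> {(s, k), (s, k + 1), (s - 1, k)}" for s' k'
    unfolding up_at_def down_at_def Int_commute[of "down_triangle _ _"] up_triangle_Int_down by auto
  moreover have "card (down_at s k \<inter> down_at s' k') \<noteq> 2" for s' k'
    unfolding down_at_def by (rule down_triangle_Int_down)
  ultimately show ?thesis
    by (auto simp: lozenge_iff unit_triangles_eq)
qed

section \<open>The hexagon in lattice coordinates\<close>

lemma convex_hull_halfplane:
  assumes "p \<in> convex hull S" "\<And>v. v \<in> S \<Longrightarrow> \<alpha> * fst v + \<beta> * (snd v / lattice_height) \<le> \<gamma>"
  shows "\<alpha> * fst p + \<beta> * (snd p / lattice_height) \<le> \<gamma>"
proof -
  \<comment> \<open>Division by \<open>lattice_height\<close> turns the second coordinate into the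
    row number, so that the sides of the hexagon get rational coefficients.\<close>
  have "convex hull S \<subseteq> {p. inner (\<alpha>, \<beta> / lattice_height) p \<le> \<gamma>}"
    by (intro hull_minimal convex_halfspace_le) (use assms(2) in \<open>auto simp: inner_prod_def\<close>)
  then show ?thesis using assms(1) by (auto simp: inner_prod_def)
qed

text \<open>Each inequality is the half-plane of one side. Conversely, the horizontal chord through
  the point ends on two sides, whose points are convex combinations of vertices.\<close>

lemma lattice_point_in_hexagon_iff:
  "lattice_point i k \<in> hexagon a b c \<longleftrightarrow>
     0 \<le> k \<and> k \<le> int (a + b + 2) \<and> - int (a + 1) \<le> i \<and> i \<le> int (c + 1) \<and>
     0 \<le> i + k \<and> i + k \<le> int (b + c + 1)"
  (is "?P \<longleftrightarrow> ?Q")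
proof
  let ?h = lattice_height
  have h: "?h \<noteq> 0" using lattice_height_pos by simp
  assume P: ?P
  have "0 * fst (lattice_point i k) + (- 1) * (snd (lattice_point i k) / ?h) \<le> 0"
    by (rule convex_hull_halfplane[OF P[unfolded hexagon_def]]) (use h in auto)
  then have 1: "0 \<le> real_of_int k" using h by (simp add: lattice_point_def)
  have "0 * fst (lattice_point i k) + 1 * (snd (lattice_point i k) / ?h) \<le> real (a + b + 2)"
    by (rule convex_hull_halfplane[OF P[unfolded hexagon_def]]) (use h in auto)
  then have 2: "real_of_int k \<le> real (a + b + 2)" using h by (simp add: lattice_point_def)
  have "(- 1) * fst (lattice_point i k) + (1 / 2) * (snd (lattice_point i k) / ?h) \<le> real (a + 1)"
    by (rule convex_hull_halfplane[OF P[unfolded hexagon_def]]) (use h in \<open>auto simp: add_divide_distrib diff_divide_distrib\<close>)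
  then have 3: "- real (a + 1) \<le> real_of_int i" using h by (simp add: lattice_point_def)
  have "1 * fst (lattice_point i k) + (- 1 / 2) * (snd (lattice_point i k) / ?h) \<le> real (c + 1)"
    by (rule convex_hull_halfplane[OF P[unfolded hexagon_def]]) (use h in \<open>auto simp: add_divide_distrib diff_divide_distrib\<close>)
  then have 4: "real_of_int i \<le> real (c + 1)" using h by (simp add: lattice_point_def)
  have "(- 1) * fst (lattice_point i k) + (- 1 / 2) * (snd (lattice_point i k) / ?h) \<le> 0"
    by (rule convex_hull_halfplane[OF P[unfolded hexagon_def]]) (use h in \<open>auto simp: add_divide_distrib diff_divide_distrib\<close>)
  then have 5: "0 \<le> real_of_int (i + k)" using h by (simp add: lattice_point_def)
  have "1 * fst (lattice_point i k) + (1 / 2) * (snd (lattice_point i k) / ?h) \<le> real (b + c + 1)"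
    by (rule convex_hull_halfplane[OF P[unfolded hexagon_def]]) (use h in \<open>auto simp: add_divide_distrib diff_divide_distrib\<close>)
  then have 6: "real_of_int (i + k) \<le> real (b + c + 1)" using h by (simp add: lattice_point_def)
  show ?Q using 1 2 3 4 5 6 by linarith
next
  assume Q: ?Q
  define L where "L = (\<lambda>u v. (u + v / 2, v * lattice_height))"
  let ?S = "hexagon a b c"
  have "convex ?S" by (simp add: hexagon_def)
  have seg: "L u v \<in> ?S"
    if "L u1 v1 \<in> ?S" "L u2 v2 \<in> ?S" "0 \<le> t" "t \<le> 1"
      "u = u1 + t * (u2 - u1)" "v = v1 + t * (v2 - v1)" for u v u1 v1 u2 v2 t
  proof -
    have "L u v = (1 - t) *\<^sub>R L u1 v1 + t *\<^sub>R L u2 v2"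
      by (simp add: L_def that(5,6) algebra_simps add_divide_distrib diff_divide_distrib)
    then show ?thesis
      using \<open>convex ?S\<close> that by (simp add: convexD_alt)
  qed
  have vert: "L 0 0 \<in> ?S" "L (c + 1) 0 \<in> ?S" "L (c + 1) b \<in> ?S"
    "L (real c - a - 1) (a + b + 2) \<in> ?S" "L (- (real a + 1)) (a + b + 2) \<in> ?S" "L (- (real a + 1)) (a + 1) \<in> ?S"
    unfolding hexagon_def
    by (rule hull_inc, simp add: L_def field_simps)+
  define K I where "K = real_of_int k" and "I = real_of_int i"
  have KI: "0 \<le> K" "K \<le> a + b + 2" "- (real a + 1) \<le> I" "I \<le> c + 1" "0 \<le> I + K" "I + K \<le> b + c + 1"
    using Q unfolding K_def I_def by linarith+
  \<comment> \<open>The ends of the chord in row \<open>K\<close>: each side of the hexagon bends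
    once, at row \<open>a + 1\<close> on the left and at row \<open>b\<close> on the right.\<close>
  define l where "l = max (- K) (- (real a + 1))"
  define r where "r = min (real c + 1) (b + c + 1 - K)"
  have Ll: "L l K \<in> ?S"
  proof (cases "K \<le> real a + 1")
    case True
    show ?thesis
      by (rule seg[OF vert(1) vert(6), of "K / (real a + 1)"]) (use True KI in \<open>auto simp: l_def field_simps\<close>)
  next
    case False
    show ?thesis
      by (rule seg[OF vert(6) vert(5), of "(K - (real a + 1)) / (real b + 1)"])
         (use False KI in \<open>auto simp: l_def field_simps\<close>)
  qed
  have Lr: "L r K \<in> ?S"
  proof (cases "K \<le> real b")
    case True
    \<comment> \<open>For \<open>b = 0\<close> the side is a point and \<open>K\<close> is 0; the
      parameter is then \<open>0 / 0 = 0\<close>, as required.\<close>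
    show ?thesis
      by (rule seg[OF vert(2) vert(3), of "K / real b"])
         (use True KI in \<open>auto simp: r_def divide_simps\<close>)
  next
    case False
    show ?thesis
      by (rule seg[OF vert(3) vert(4), of "(K - real b) / (real a + 2)"])
         (use False KI in \<open>auto simp: r_def field_simps\<close>)
  qed
  have lr: "l \<le> I" "I \<le> r" using KI by (auto simp: l_def r_def)
  have "L I K \<in> ?S"
  \<comment> \<open>The chord can degenerate to a point, as in the top row when
    \<open>c = 0\<close>.\<close>
  proof (cases "l < r")
    case True
    then have "I = l + (I - l) / (r - l) * (r - l)" "0 \<le> (I - l) / (r - l)" "(I - l) / (r - l) \<le> 1"
      using lr by simp_all
    then show ?thesis
      by (intro seg[OF Ll Lr, of "(I - l) / (r - l)"]) simp_all
  next
    case False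
    with lr have "I = l" by simp
    with Ll show ?thesis by simp
  qed
  then show ?P by (simp add: L_def K_def I_def lattice_point_def)
qed

section \<open>The zigzag in lattice coordinates\<close>

definition zigzag_index :: "nat \<Rightarrow> int" where
  "zigzag_index n = - ((int n + 1) div 2)"

text \<open>A step $(-1/2,h)$ lowers the index by one and a step $(1/2,h)$ keeps it. The former
  start at even \<open>n = 2 * m\<close> and run along the line \<open>i + k = m\<close>; these
  edges, at height \<open>2 * m\<close>, are where the paths enter.\<close>

lemma zigzag_vertex_eq: "zigzag_vertex n = lattice_point (zigzag_index n) (int n)"
proof (cases "even n")
  case True
  then obtain m where "n = 2 * m" by blast
  then show ?thesis by (simp add: zigzag_vertex_def lattice_point_def zigzag_index_def)
next
  case False
  then obtain m where "n = 2 * m + 1" by (rule oddE)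
  then have "zigzag_index n = - int m - 1" "odd n" "real n = 2 * real m + 1"
    by (simp_all add: zigzag_index_def)
  then show ?thesis by (simp add: zigzag_vertex_def lattice_point_def field_simps)
qed

text \<open>Between two consecutive rows the zigzag is a single segment, so there lying west of it
  is a half-plane condition, and checking the vertices is enough.\<close>

lemma west_of_zigzagI:
  assumes n: "n \<le> 2 * a"
    and v: "\<And>p. p \<in> t \<Longrightarrow> \<exists>i. p = lattice_point i (int n) \<and> i \<le> zigzag_index n \<or>
      p = lattice_point i (int (Suc n)) \<and> i \<le> zigzag_index (Suc n)"
  shows "west_of_zigzag a t"
  unfolding west_of_zigzag_def
proof
  let ?h = lattice_height
  have h: "?h > 0" by (rule lattice_height_pos)
  define x where "x = (\<lambda>n. fst (zigzag_vertex n))"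
  define \<delta> where "\<delta> = x (Suc n) - x n"
  fix p assume p: "p \<in> convex hull t"
  have xs: "x m = zigzag_index m + real m / 2" for m
    by (simp add: x_def zigzag_vertex_eq lattice_point_def)
  have 1: "0 * fst p + (- 1) * (snd p / ?h) \<le> - real n"
    by (rule convex_hull_halfplane[OF p]) (use h v in \<open>force simp: lattice_point_def\<close>)
  have 2: "0 * fst p + 1 * (snd p / ?h) \<le> real (Suc n)"
    by (rule convex_hull_halfplane[OF p]) (use h v in \<open>force simp: lattice_point_def\<close>)
  have 3: "1 * fst p + (- \<delta>) * (snd p / ?h) \<le> x n - real n * \<delta>"
  proof (rule convex_hull_halfplane[OF p])
    fix q assume "q \<in> t"
    then obtain i m where q: "q = lattice_point i (int m)" "i \<le> zigzag_index m" and m: "m = n \<or> m = Suc n"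
      using v by blast
    have "1 * fst q + (- \<delta>) * (snd q / ?h) = i + real m / 2 - \<delta> * m"
      using h by (simp add: q(1) lattice_point_def)
    also have "\<dots> \<le> x m - \<delta> * m"
      using q(2) by (simp add: xs)
    also have "\<dots> = x n - real n * \<delta>"
      using m by (auto simp: \<delta>_def algebra_simps)
    finally show "1 * fst q + (- \<delta>) * (snd q / ?h) \<le> x n - real n * \<delta>" .
  qed
  define \<tau> where "\<tau> = snd p / ?h - real n"
  \<comment> \<open>The point of this segment at the height of \<open>p\<close>.\<close>
  define q where "q = (1 - \<tau>) *\<^sub>R zigzag_vertex n + \<tau> *\<^sub>R zigzag_vertex (Suc n)"
  have "0 \<le> \<tau>" "\<tau> \<le> 1" using 1 2 by (simp_all add: \<tau>_def)
  then have "q \<in> closed_segment (zigzag_vertex n) (zigzag_vertex (Suc n))"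
    unfolding q_def closed_segment_def by blast
  then have "q \<in> zigzag a" using n by (auto simp: zigzag_def)
  moreover have "snd q = snd p"
    using h by (simp add: q_def zigzag_vertex_def \<tau>_def field_simps)
  moreover have "fst q = x n + \<tau> * \<delta>" by (simp add: q_def x_def \<delta>_def algebra_simps)
  then have "fst p \<le> fst q" using 3 by (simp add: \<tau>_def algebra_simps)
  ultimately show "\<exists>q\<in>zigzag a. snd q = snd p \<and> fst p \<le> fst q" by blast
qed

text \<open>Every segment of the zigzag rises exactly one row, so at the height of a lattice point
  it can only be met in an end point.\<close>

lemma west_of_zigzagD:
  assumes west: "west_of_zigzag a t" and v: "lattice_point i (int n) \<in> t"
  shows "n \<le> 2 * a + 1" "i \<le> zigzag_index n"
proof -
  have h: "lattice_height > 0" by (rule lattice_height_pos)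
  have "lattice_point i (int n) \<in> convex hull t" using v by (rule hull_inc)
  then obtain q where q: "q \<in> zigzag a" "snd q = real n * lattice_height" "i + real n / 2 \<le> fst q"
    using west by (force simp: west_of_zigzag_def lattice_point_def)
  then obtain m \<tau> where m: "m < 2 * a + 1" and \<tau>: "0 \<le> \<tau>" "\<tau> \<le> 1"
    and q_eq: "q = (1 - \<tau>) *\<^sub>R zigzag_vertex m + \<tau> *\<^sub>R zigzag_vertex (Suc m)"
    by (auto simp: zigzag_def closed_segment_def)
  have "snd q = (real m + \<tau>) * lattice_height"
    by (simp add: q_eq zigzag_vertex_def algebra_simps)
  then have "real n = real m + \<tau>" using q(2) h by simp
  moreover from this have "m \<le> n" "n \<le> Suc m" using \<tau> by linarith+
  ultimately have "n = m \<and> \<tau> = 0 \<or> n = Suc m \<and> \<tau> = 1" by (auto simp: le_Suc_eq)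
  then have "n \<le> 2 * a + 1 \<and> q = zigzag_vertex n" using m by (auto simp: q_eq)
  then show "n \<le> 2 * a + 1" "i \<le> zigzag_index n"
    using q(3) by (auto simp: zigzag_vertex_eq lattice_point_def)
qed

lemma west_of_zigzag_up_iff:
  "west_of_zigzag a (up_triangle i (int n)) \<longleftrightarrow>
     n \<le> 2 * a \<and> i + 1 \<le> zigzag_index n \<and> i \<le> zigzag_index (Suc n)"
proof
  assume w: "west_of_zigzag a (up_triangle i (int n))"
  have "lattice_point (i + 1) (int n) \<in> up_triangle i (int n)"
    "lattice_point i (int (Suc n)) \<in> up_triangle i (int n)"
    by (auto simp: up_triangle_def lattice_point_eq_iff)
  from this[THEN west_of_zigzagD(1)[OF w]] this[THEN west_of_zigzagD(2)[OF w]]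
  show "n \<le> 2 * a \<and> i + 1 \<le> zigzag_index n \<and> i \<le> zigzag_index (Suc n)" by simp
next
  assume "n \<le> 2 * a \<and> i + 1 \<le> zigzag_index n \<and> i \<le> zigzag_index (Suc n)"
  then show "west_of_zigzag a (up_triangle i (int n))"
    by (intro west_of_zigzagI[of n]) (auto simp: up_triangle_def lattice_point_eq_iff)
qed

lemma west_of_zigzag_down_iff:
  "west_of_zigzag a (down_triangle i (int n)) \<longleftrightarrow>
     n \<le> 2 * a \<and> i + 1 \<le> zigzag_index n \<and> i + 1 \<le> zigzag_index (Suc n)"
proof
  assume w: "west_of_zigzag a (down_triangle i (int n))"
  have "lattice_point (i + 1) (int n) \<in> down_triangle i (int n)"
    "lattice_point (i + 1) (int (Suc n)) \<in> down_triangle i (int n)"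
    by (auto simp: down_triangle_def lattice_point_eq_iff)
  from this[THEN west_of_zigzagD(1)[OF w]] this[THEN west_of_zigzagD(2)[OF w]]
  show "n \<le> 2 * a \<and> i + 1 \<le> zigzag_index n \<and> i + 1 \<le> zigzag_index (Suc n)" by simp
next
  assume "n \<le> 2 * a \<and> i + 1 \<le> zigzag_index n \<and> i + 1 \<le> zigzag_index (Suc n)"
  then show "west_of_zigzag a (down_triangle i (int n))"
    by (intro west_of_zigzagI[of n]) (auto simp: down_triangle_def lattice_point_eq_iff)
qed

text \<open>In \<open>ups\<close> and \<open>downs\<close>, the bounds \<open>2 * s + 1\<close> and
  \<open>2 * s\<close> come from the zigzag, \<open>s + int a + 1\<close> and
  \<open>s + int a\<close> from the northwest side, \<open>s - int c\<close> and
  \<open>s - 1 - int c\<close> from the southeast side. In the rows above the end of the zigzag the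
  northwest bound implies the zigzag bound, which saves a case distinction.\<close>

definition ups :: "nat \<Rightarrow> nat \<Rightarrow> nat \<Rightarrow> int \<Rightarrow> int set" where
  "ups a b c s = {k. 0 \<le> s \<and> s \<le> int (b + c) \<and> 0 \<le> k \<and> k \<le> int (a + b + 1) \<and>
     k \<le> 2 * s + 1 \<and> k \<le> s + int a + 1 \<and> s - int c \<le> k}"

definition downs :: "nat \<Rightarrow> nat \<Rightarrow> nat \<Rightarrow> int \<Rightarrow> int set" where
  "downs a b c s = {k. 0 \<le> s \<and> s \<le> int (b + c) \<and> 0 \<le> k \<and> k \<le> int (a + b + 1) \<and>
     k \<le> 2 * s \<and> k \<le> s + int a \<and> s - 1 - int c \<le> k}"

lemma hull_in_hexagon_iff:
  "convex hull t \<subseteq> hexagon a b c \<longleftrightarrow> t \<subseteq> hexagon a b c"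
proof
  show "t \<subseteq> hexagon a b c" if "convex hull t \<subseteq> hexagon a b c"
    using hull_subset that by (rule order_trans)
  show "convex hull t \<subseteq> hexagon a b c" if "t \<subseteq> hexagon a b c"
    using that by (rule hull_minimal) (simp add: hexagon_def)
qed

lemma zigzag_index_double:
  "zigzag_index (2 * m) = - int m" "zigzag_index (Suc (2 * m)) = - int m - 1"
  "zigzag_index (Suc (Suc (2 * m))) = - int m - 1"
  by (simp_all add: zigzag_index_def)

lemma up_at_in_region_iff:
  assumes "a \<le> b + 1"
  shows "convex hull (up_at s k) \<subseteq> hexagon a b c \<and> \<not> west_of_zigzag a (up_at s k) \<longleftrightarrow> k \<in> ups a b c s"
proof (cases "0 \<le> k")
  case True
  then obtain n where k: "k = int n" using nonneg_int_cases by blast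
  consider m where "n = 2 * m" | m where "n = Suc (2 * m)"
    by (metis evenE oddE Suc_eq_plus1)
  then show ?thesis
    unfolding hull_in_hexagon_iff up_at_def k west_of_zigzag_up_iff
    unfolding up_triangle_def ups_def mem_Collect_eq insert_subset lattice_point_in_hexagon_iff
    using assms by cases (simp only: zigzag_index_double empty_subsetI simp_thms, intro iffI conjI; linarith)+
next
  case False
  then show ?thesis
    by (simp add: hull_in_hexagon_iff up_at_def up_triangle_def lattice_point_in_hexagon_iff ups_def)
qed

lemma down_at_in_region_iff:
  assumes "a \<le> b + 1"
  shows "convex hull (down_at s k) \<subseteq> hexagon a b c \<and> \<not> west_of_zigzag a (down_at s k) \<longleftrightarrow> k \<in> downs a b c s"
proof (cases "0 \<le> k")
  case True
  then obtain n where k: "k = int n" using nonneg_int_cases by blast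
  consider m where "n = 2 * m" | m where "n = Suc (2 * m)"
    by (metis evenE oddE Suc_eq_plus1)
  then show ?thesis
    unfolding hull_in_hexagon_iff down_at_def k west_of_zigzag_down_iff
    unfolding down_triangle_def downs_def mem_Collect_eq insert_subset lattice_point_in_hexagon_iff
    using assms by cases (simp only: zigzag_index_double empty_subsetI simp_thms, intro iffI conjI; linarith)+
next
  case False
  then show ?thesis
    by (simp add: hull_in_hexagon_iff down_at_def down_triangle_def lattice_point_in_hexagon_iff downs_def)
qed

lemma S_region_eq:
  assumes "a \<le> b + 1"
  shows "S_region a b c =
    {up_at s k | s k. k \<in> ups a b c s} \<union> {down_at s k | s k. k \<in> downs a b c s} - {up_at (int (b + c)) (int (b + 1))}"
proof -
  have "dent b c = up_at (int (b + c)) (int (b + 1))"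
    by (simp add: dent_def up_at_def up_triangle_def lattice_point_def field_simps insert_commute)
  then show ?thesis
    unfolding S_region_def unit_triangles_eq
    using up_at_in_region_iff[OF assms, of _ _ c] down_at_in_region_iff[OF assms, of _ _ c] by blast
qed

section \<open>Transfer from strip to strip\<close>

text \<open>The paths that enter through the zigzag on the line \<open>i + k = s\<close>.\<close>
definition entry_pos :: "nat \<Rightarrow> int \<Rightarrow> int set" where
  "entry_pos a s = (if s \<le> int a then {2 * s} else {})"

text \<open>Passing from \<open>s - 1\<close> to \<open>s\<close>, all bounds agree except that the
  zigzag bound grows from \<open>2 * s - 1\<close> to \<open>2 * s\<close>. The additional position
  is a zigzag edge and exists as long as \<open>2 * s \<le> s + a\<close>.\<close>

lemma downs_eq:
  assumes "a \<le> b + 1" "0 \<le> s" "s \<le> int (b + c)"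
  shows "downs a b c s = ups a b c (s - 1) \<union> entry_pos a s"
    and "ups a b c (s - 1) \<inter> entry_pos a s = {}"
  using assms by (auto simp: downs_def ups_def entry_pos_def)

text \<open>The part before the line \<open>i + k = s\<close>, when exactly the up-triangles with index in \<open>Y\<close> of the last
  strip are to be covered within this part.\<close>
definition partial_region :: "nat \<Rightarrow> nat \<Rightarrow> nat \<Rightarrow> int \<Rightarrow> int set \<Rightarrow> triangle set" where
  "partial_region a b c s Y =
     {up_at r k | r k. r < s - 1 \<and> k \<in> ups a b c r} \<union>
     {down_at r k | r k. r < s \<and> k \<in> downs a b c r} \<union> up_at (s - 1) ` Y"

lemma up_at_in_partial_region [simp]:
  "up_at r k \<in> partial_region a b c s Y \<longleftrightarrow> r < s - 1 \<and> k \<in> ups a b c r \<or> r = s - 1 \<and> k \<in> Y"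
  by (auto simp: partial_region_def)

lemma down_at_in_partial_region [simp]:
  "down_at r k \<in> partial_region a b c s Y \<longleftrightarrow> r < s \<and> k \<in> downs a b c r"
  by (auto simp: partial_region_def)

lemma triangle_in_image [simp]:
  "up_at r k \<in> up_at s ` W \<longleftrightarrow> r = s \<and> k \<in> W"
  "down_at r k \<in> down_at s ` W \<longleftrightarrow> r = s \<and> k \<in> W"
  "up_at r k \<notin> down_at s ` W"
  "down_at r k \<notin> up_at s ` W"
  by auto

lemma partial_region_subset: "partial_region a b c s Y \<subseteq> unit_triangles"
  unfolding partial_region_def unit_triangles_eq by blast

lemma image_subset_unit_triangles: "up_at s ` W \<subseteq> unit_triangles" "down_at s ` W \<subseteq> unit_triangles"
  unfolding unit_triangles_eq by blast+

lemma region_eqI: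
  assumes "A \<subseteq> unit_triangles" "B \<subseteq> unit_triangles"
    and "\<And>s k. up_at s k \<in> A \<longleftrightarrow> up_at s k \<in> B" "\<And>s k. down_at s k \<in> A \<longleftrightarrow> down_at s k \<in> B"
  shows "A = B"
proof (rule Set.set_eqI)
  fix t
  show "t \<in> A \<longleftrightarrow> t \<in> B"
  proof (cases "t \<in> unit_triangles")
    case True
    then obtain s k where "t = up_at s k \<or> t = down_at s k" unfolding unit_triangles_eq by blast
    then show ?thesis using assms(3,4) by (elim disjE) simp_all
  next
    case False
    then show ?thesis using assms(1,2) by blast
  qed
qed

lemma finite_ups: "finite (ups a b c s)"
  by (rule finite_subset[of _ "{0..int (a + b + 1)}"]) (auto simp: ups_def)

lemma finite_partial_region:
  assumes "finite Y"
  shows "finite (partial_region a b c s Y)"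
proof -
  have "partial_region a b c s Y \<subseteq>
      (\<lambda>(r, k). up_at r k) ` ({0..int (b + c)} \<times> {0..int (a + b + 1)}) \<union>
      (\<lambda>(r, k). down_at r k) ` ({0..int (b + c)} \<times> {0..int (a + b + 1)}) \<union> up_at (s - 1) ` Y"
    by (auto simp: partial_region_def ups_def downs_def image_iff)
  then show ?thesis
    by (rule finite_subset) (use assms in auto)
qed

text \<open>The unmatched down-triangles of strip \<open>s\<close> are forced to pair with their neighbours in
  strip \<open>s - 1\<close>.\<close>
lemma num_tilings_forced_downs:
  assumes "W \<subseteq> downs a b c s"
  shows "num_tilings (partial_region a b c s (ups a b c (s - 1)) \<union> down_at s ` W) =
    (if W \<subseteq> ups a b c (s - 1) then num_tilings (partial_region a b c s (ups a b c (s - 1) - W)) else 0)"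
proof -
  let ?U = "ups a b c (s - 1)"
  define R where "R = partial_region a b c s ?U \<union> down_at s ` W"
  define V where "V = down_at s ` W"
  define H where "H = {h \<in> V \<rightarrow>\<^sub>E R - V. inj_on h V \<and> (\<forall>v\<in>V. {v, h v} \<in> lozenges)}"
  have "finite W"
    using assms by (rule finite_subset) (rule finite_subset[of _ "{0..int (a + b + 1)}"], auto simp: downs_def)
  then have fin: "finite R" by (simp add: R_def finite_partial_region finite_ups)
  have sum: "num_tilings R = (\<Sum>h\<in>H. num_tilings (R - V - h ` V))"
    unfolding H_def
  proof (rule num_tilings_remove[OF fin])
    show "V \<subseteq> R" by (simp add: V_def R_def)
    show "{v, w} \<notin> lozenges" if vw: "v \<in> V" "w \<in> V" for v w
    proof -
      obtain k l where "v = down_at s k" "w = down_at s l" using vw unfolding V_def by blast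
      then show ?thesis by (simp add: lozenge_down_at_iff)
    qed
  qed
  \<comment> \<open>\<open>R\<close> contains no up-triangles of strip \<open>s\<close>, so of the
    three neighbours only the one in strip \<open>s - 1\<close> remains.\<close>
  have mem: "t = up_at (s - 1) k \<and> k \<in> ?U" if t: "t \<in> R" "{down_at s k, t} \<in> lozenges" for t k
    using t(2)[unfolded lozenge_down_at_iff] t(1) by (elim disjE) (simp_all add: R_def)
  have H: "h (down_at s k) = up_at (s - 1) k \<and> k \<in> ?U" if "h \<in> H" "k \<in> W" for h k
  proof (rule mem)
    have "down_at s k \<in> V" using that(2) by (simp add: V_def)
    then show "h (down_at s k) \<in> R" "{down_at s k, h (down_at s k)} \<in> lozenges"
      using that(1) unfolding H_def by blast+
  qed
  show ?thesis
  proof (cases "W \<subseteq> ?U")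
    case False
    then have "H = {}" using H by blast
    then show ?thesis using sum False by (simp add: R_def)
  next
    case True
    define h0 where "h0 = (\<lambda>v\<in>V. up_at (s - 1) (THE k. v = down_at s k))"
    have h0: "h0 (down_at s k) = up_at (s - 1) k" if "k \<in> W" for k
      using that by (simp add: h0_def V_def)
    have up_in: "up_at (s - 1) k \<in> R - V" if "k \<in> W" for k
      using that True by (simp add: R_def V_def subset_iff)
    have h0_V: "h0 ` V = up_at (s - 1) ` W"
      unfolding V_def image_image by (rule image_cong) (simp_all add: h0)
    have V_E: "\<exists>k\<in>W. v = down_at s k" if "v \<in> V" for v
      using that unfolding V_def by blast
    have "h0 \<in> H"
    proof -
      have "h0 \<in> V \<rightarrow>\<^sub>E R - V"
      proof (rule PiE_I)
        show "h0 v \<in> R - V" if "v \<in> V" for v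
          using V_E[OF that] up_in by (metis h0)
      qed (simp add: h0_def)
      moreover have "inj_on h0 V"
        unfolding V_def by (intro inj_onI) (elim imageE, simp add: h0)
      moreover have "{v, h0 v} \<in> lozenges" if v: "v \<in> V" for v
      proof -
        obtain k where "k \<in> W" "v = down_at s k" using V_E[OF v] by blast
        then show ?thesis by (simp add: h0 lozenge_down_at_iff)
      qed
      ultimately show ?thesis unfolding H_def by blast
    qed
    moreover have "h = h0" if h: "h \<in> H" for h
    proof (rule PiE_ext[of h V "\<lambda>_. R - V"])
      show "h \<in> V \<rightarrow>\<^sub>E R - V" "h0 \<in> V \<rightarrow>\<^sub>E R - V" using h \<open>h0 \<in> H\<close> unfolding H_def by blast+
      show "h v = h0 v" if v: "v \<in> V" for v
      proof -
        obtain k where k: "k \<in> W" "v = down_at s k" using V_E[OF v] by blast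
        then show ?thesis using H[OF h k(1)] by (simp add: h0)
      qed
    qed
    ultimately have "H = {h0}" by blast
    moreover have "R - V - h0 ` V = partial_region a b c s (?U - W)"
    proof (rule region_eqI)
      show "R - V - h0 ` V \<subseteq> unit_triangles"
        unfolding R_def using partial_region_subset image_subset_unit_triangles by blast
    qed (unfold h0_V, use True in \<open>auto simp: R_def V_def partial_region_subset\<close>)
    ultimately show ?thesis using sum True by (simp add: R_def)
  qed
qed

text \<open>The partner in strip \<open>s\<close> of \<open>up_at s k\<close> is \<open>down_at s (shift_except X k)\<close>, where \<open>X\<close> records the steps
  in horizontal direction.\<close>
definition shift_except :: "int set \<Rightarrow> int \<Rightarrow> int" where
  "shift_except X k = (if k \<in> X then k else k - 1)"

text \<open>Matching off the up-triangles of strip \<open>s\<close> leaves two candidates for each,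
  since the third neighbour \<open>down_at (s + 1) k\<close> lies beyond the region. The other
  down-triangles of the strip must then pair backwards. The one at a zigzag edge has no neighbour
  there, so it has to be among the matched ones.\<close>

lemma num_tilings_strip:
  assumes a: "a \<le> b + 1" and s: "0 \<le> s" "s \<le> int (b + c)" and Y: "Y \<subseteq> ups a b c s"
  shows "num_tilings (partial_region a b c (s + 1) Y) =
    (\<Sum>X\<in>Pow Y. if inj_on (shift_except X) Y \<and> shift_except X ` Y \<subseteq> downs a b c s \<and>
        entry_pos a s \<subseteq> shift_except X ` Y
      then num_tilings (partial_region a b c s (shift_except X ` Y - entry_pos a s)) else 0)"
proof -
  define R where "R = partial_region a b c (s + 1) Y"
  define V where "V = up_at s ` Y"
  define H where "H = {h \<in> V \<rightarrow>\<^sub>E R - V. inj_on h V \<and> (\<forall>v\<in>V. {v, h v} \<in> lozenges)}"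
  define P where "P = {X \<in> Pow Y. inj_on (shift_except X) Y \<and> shift_except X ` Y \<subseteq> downs a b c s}"
  define matching where "matching = (\<lambda>X. \<lambda>v\<in>V. down_at s (shift_except X (THE k. v = up_at s k)))"
  have "finite Y" using Y finite_ups by (rule finite_subset)
  have sum: "num_tilings R = (\<Sum>h\<in>H. num_tilings (R - V - h ` V))"
    unfolding H_def
  proof (rule num_tilings_remove)
    show "finite R" unfolding R_def by (rule finite_partial_region) fact
    show "V \<subseteq> R" by (auto simp: V_def R_def)
    show "{v, w} \<notin> lozenges" if vw: "v \<in> V" "w \<in> V" for v w
    proof -
      obtain k l where "v = up_at s k" "w = up_at s l" using vw unfolding V_def by blast
      then show ?thesis by (simp add: lozenge_up_at_iff)
    qed
  qed
  have m: "matching X (up_at s k) = down_at s (shift_except X k)" if "k \<in> Y" for X k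
    using that by (simp add: matching_def V_def)
  have down_iff: "down_at s k \<in> R - V \<longleftrightarrow> k \<in> downs a b c s" for k
    by (simp add: R_def V_def)
  have H: "(h (up_at s k) = down_at s k \<or> h (up_at s k) = down_at s (k - 1)) \<and> h (up_at s k) \<in> R - V"
    if "h \<in> H" "k \<in> Y" for h k
  proof -
    have "up_at s k \<in> V" using that(2) by (simp add: V_def)
    then have h: "h (up_at s k) \<in> R - V" and loz: "{up_at s k, h (up_at s k)} \<in> lozenges"
      using that(1) unfolding H_def by blast+
    from loz[unfolded lozenge_up_at_iff] show ?thesis
    proof (elim disjE)
      assume "h (up_at s k) = down_at (s + 1) k"
      with h show ?thesis by (simp add: R_def)
    qed (use h in simp_all)
  qed
  have V_E: "\<exists>k\<in>Y. v = up_at s k" if "v \<in> V" for v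
    using that unfolding V_def by blast
  have "(\<Sum>h\<in>H. num_tilings (R - V - h ` V)) = (\<Sum>X\<in>P. num_tilings (R - V - matching X ` V))"
  proof (rule sum.reindex_bij_witness[of _ matching "\<lambda>h. {k \<in> Y. h (up_at s k) = down_at s k}"])
    fix X assume X: "X \<in> P"
    show "{k \<in> Y. matching X (up_at s k) = down_at s k} = X"
      using X by (auto simp: P_def m shift_except_def split: if_splits)
    have "matching X \<in> V \<rightarrow>\<^sub>E R - V"
    proof (rule PiE_I)
      fix v assume "v \<in> V"
      then obtain k where k: "v = up_at s k" "k \<in> Y" using V_E by blast
      then have "shift_except X k \<in> downs a b c s" using X by (auto simp: P_def)
      then show "matching X v \<in> R - V" by (simp only: k m down_iff)
    qed (simp add: matching_def)
    moreover have "inj_on (matching X) V"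
    proof (rule inj_onI)
      fix v w assume vw: "v \<in> V" "w \<in> V" "matching X v = matching X w"
      obtain k l where kl: "k \<in> Y" "v = up_at s k" "l \<in> Y" "w = up_at s l"
        using V_E[OF vw(1)] V_E[OF vw(2)] by blast
      have "shift_except X k = shift_except X l" using vw(3) kl by (simp add: m)
      then have "k = l" using X kl(1,3) unfolding P_def by (blast dest: inj_onD)
      then show "v = w" by (simp add: kl)
    qed
    moreover have "{v, matching X v} \<in> lozenges" if v: "v \<in> V" for v
    proof -
      obtain k where "k \<in> Y" "v = up_at s k" using V_E[OF v] by blast
      then show ?thesis by (simp add: m lozenge_up_at_iff shift_except_def)
    qed
    ultimately show "matching X \<in> H" unfolding H_def by blast
  next
    fix h assume h: "h \<in> H"
    let ?X = "{k \<in> Y. h (up_at s k) = down_at s k}"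
    have hX: "h (up_at s k) = down_at s (shift_except ?X k)" if "k \<in> Y" for k
      using H[OF h that] that by (simp add: shift_except_def) blast
    show "matching ?X = h"
    proof (rule PiE_ext[of _ V "\<lambda>_. UNIV"])
      show "matching ?X \<in> V \<rightarrow>\<^sub>E UNIV" by (simp add: matching_def)
      show "h \<in> V \<rightarrow>\<^sub>E UNIV" using h by (simp add: H_def PiE_def)
      show "matching ?X v = h v" if v: "v \<in> V" for v
      proof -
        obtain k where "k \<in> Y" "v = up_at s k" using V_E[OF v] by blast
        then show ?thesis by (simp only: m hX)
      qed
    qed
    then show "num_tilings (R - V - matching ?X ` V) = num_tilings (R - V - h ` V)" by simp
    have "inj_on (shift_except ?X) Y"
    proof (rule inj_onI)
      fix k l assume kl: "k \<in> Y" "l \<in> Y" "shift_except ?X k = shift_except ?X l"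
      then have eq: "h (up_at s k) = h (up_at s l)" by (simp only: hX)
      have "inj_on h V" using h by (simp add: H_def)
      then have "up_at s k = up_at s l"
        by (rule inj_onD[of h V "up_at s k" "up_at s l"]) (simp_all only: eq V_def triangle_in_image kl simp_thms)
      then show "k = l" by simp
    qed
    moreover have "shift_except ?X ` Y \<subseteq> downs a b c s"
    proof
      fix x assume "x \<in> shift_except ?X ` Y"
      then obtain k where k: "k \<in> Y" "x = shift_except ?X k" by blast
      have "down_at s x \<in> R - V" using H[OF h k(1)] hX[OF k(1)] k(2) by (simp only:)
      then show "x \<in> downs a b c s" by (simp only: down_iff)
    qed
    ultimately show "?X \<in> P" by (simp add: P_def)
  qed
  also have "\<dots> = (\<Sum>X\<in>P. if entry_pos a s \<subseteq> shift_except X ` Y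
      then num_tilings (partial_region a b c s (shift_except X ` Y - entry_pos a s)) else 0)"
  proof (rule sum.cong[OF refl])
    fix X assume X: "X \<in> P"
    define Z where "Z = shift_except X ` Y"
    have Z: "Z \<subseteq> downs a b c s" using X by (simp add: P_def Z_def)
    note de = downs_eq[OF a s]
    have "matching X ` V = down_at s ` Z"
      unfolding V_def Z_def image_image by (rule image_cong) (simp_all add: m)
    then have "R - V - matching X ` V =
        partial_region a b c s (ups a b c (s - 1)) \<union> down_at s ` (downs a b c s - Z)"
      unfolding V_def
    proof (intro region_eqI)
      show "R - up_at s ` Y - matching X ` up_at s ` Y \<subseteq> unit_triangles"
        unfolding R_def using partial_region_subset by blast
      show "partial_region a b c s (ups a b c (s - 1)) \<union> down_at s ` (downs a b c s - Z) \<subseteq> unit_triangles"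
        using partial_region_subset image_subset_unit_triangles by blast
      show "up_at r k \<in> R - up_at s ` Y - matching X ` up_at s ` Y \<longleftrightarrow>
          up_at r k \<in> partial_region a b c s (ups a b c (s - 1)) \<union> down_at s ` (downs a b c s - Z)" for r k
        using \<open>matching X ` V = down_at s ` Z\<close> by (cases "r = s - 1") (auto simp: R_def V_def)
    qed (auto simp: R_def V_def)
    moreover have "downs a b c s - Z \<subseteq> ups a b c (s - 1) \<longleftrightarrow> entry_pos a s \<subseteq> Z"
      using de by blast
    moreover have "ups a b c (s - 1) - (downs a b c s - Z) = Z - entry_pos a s"
      using de Z by blast
    ultimately show "num_tilings (R - V - matching X ` V) =
       (if entry_pos a s \<subseteq> shift_except X ` Y
        then num_tilings (partial_region a b c s (shift_except X ` Y - entry_pos a s)) else 0)"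
      by (simp add: num_tilings_forced_downs Z_def)
  qed
  also have "\<dots> = (\<Sum>X\<in>Pow Y. if inj_on (shift_except X) Y \<and> shift_except X ` Y \<subseteq> downs a b c s \<and>
        entry_pos a s \<subseteq> shift_except X ` Y
      then num_tilings (partial_region a b c s (shift_except X ` Y - entry_pos a s)) else 0)"
    unfolding P_def using \<open>finite Y\<close>
    by (subst sum.inter_filter) (auto intro!: sum.cong)
  finally show ?thesis using sum by (simp add: R_def)
qed

section \<open>Path families and the determinant\<close>

lemma binom_pascal: "binom (Suc n) k = binom n k + binom n (k - 1)"
proof -
  consider "k < 0" | "k = 0" | m where "k = int (Suc m)"
    by (metis int_cases not_less_iff_gr_or_eq old.nat.exhaust of_nat_0 negative_zless of_nat_less_0_iff)
  then show ?thesis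
    by cases (auto simp: binom_def nat_add_distrib)
qed

lemma binom_eq_0: "k < 0 \<or> int n < k \<Longrightarrow> binom n k = 0"
  by (auto simp: binom_def)

text \<open>One path enters on each of the lines \<open>0\<close> to \<open>a\<close>, hence the
  minimum. In the induction step the choices \<open>X\<close> of the strip sum are compared one by
  one with those of \<open>dt_add_rows\<close>: an excluded choice has a vanishing determinant, an
  admissible one is given by the induction hypothesis. Pascal's rule then reassembles the
  rows.\<close>

lemma num_tilings_partial_region:
  assumes a: "a \<le> b + 1" and "s \<le> b + c + 1"
    and "n = min s (a + 1)" "strict_mono_on {0..<n} y" "y ` {0..<n} \<subseteq> ups a b c (int s - 1)"
  shows "real (num_tilings (partial_region a b c (int s) (y ` {0..<n}))) =
    dt n (\<lambda>i j. real (binom (s - j) (y i - 2 * int j)))"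
  using assms(2-5)
proof (induction s arbitrary: n y)
  case 0
  have "partial_region a b c 0 {} = {}"
    by (auto simp: partial_region_def ups_def downs_def)
  then show ?case
    using 0 by (simp add: num_tilings_def lozenge_tilings_def partition_on_empty dt_leibniz Collect_conv_if)
next
  case (Suc s)
  define Y where "Y = y ` {0..<n}"
  have inj: "inj_on y {0..<n}"
    using Suc.prems(3) by (rule strict_mono_on_imp_inj_on)
  have Y: "Y \<subseteq> ups a b c (int s)" using Suc.prems(4) by (simp add: Y_def)
  define x where "x = (\<lambda>X i. if i \<in> X then y i else y i - 1)"
  have x_eq: "shift_except (y ` X) (y i) = x X i" if "X \<in> Pow {0..<n}" "i < n" for X i
    using that inj_on_image_mem_iff[OF inj, of i X] by (simp add: shift_except_def x_def)
  define T where "T = (\<lambda>X. if inj_on (shift_except X) Y \<and> shift_except X ` Y \<subseteq> downs a b c s \<and>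
        entry_pos a s \<subseteq> shift_except X ` Y
      then num_tilings (partial_region a b c s (shift_except X ` Y - entry_pos a s)) else 0)"
  have n_le: "n \<le> Suc s" "n \<le> Suc a" using Suc.prems by auto
  have term_eq: "real (T (y ` X)) = dt n (\<lambda>i j. real (binom (s - j) (x X i - 2 * int j)))"
    if X: "X \<in> Pow {0..<n}" for X
  proof -
    have img: "shift_except (y ` X) ` Y = x X ` {0..<n}"
      unfolding Y_def image_image by (rule image_cong) (auto simp: x_eq[OF X])
    have inj_iff: "inj_on (shift_except (y ` X)) Y \<longleftrightarrow> inj_on (x X) {0..<n}"
    proof -
      have "inj_on (shift_except (y ` X)) Y \<longleftrightarrow> inj_on (shift_except (y ` X) \<circ> y) {0..<n}"
        unfolding Y_def using inj by (simp add: comp_inj_on_iff)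
      also have "\<dots> \<longleftrightarrow> inj_on (x X) {0..<n}"
        by (rule inj_on_cong) (simp add: x_eq[OF X])
      finally show ?thesis .
    qed
    have T_eq: "T (y ` X) = (if inj_on (x X) {0..<n} \<and> x X ` {0..<n} \<subseteq> downs a b c s \<and>
        entry_pos a s \<subseteq> x X ` {0..<n}
      then num_tilings (partial_region a b c s (x X ` {0..<n} - entry_pos a s)) else 0)"
      unfolding T_def img inj_iff ..
    consider (dup) "\<not> inj_on (x X) {0..<n}" | (out) "\<not> x X ` {0..<n} \<subseteq> downs a b c s" |
      (ok) "inj_on (x X) {0..<n}" "x X ` {0..<n} \<subseteq> downs a b c s" by blast
    then show ?thesis
    proof cases
      case dup
      then obtain i k where "i < n" "k < n" "i \<noteq> k" "x X i = x X k"
        by (auto simp: inj_on_def)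
      then have "dt n (\<lambda>i j. real (binom (s - j) (x X i - 2 * int j))) = 0"
        by (intro dt_identical_rows[of i _ k]) auto
      then show ?thesis using dup by (simp add: T_eq)
    next
      case out
      then obtain i where i: "i < n" "x X i \<notin> downs a b c s" by (auto simp: image_subset_iff)
      have "y i \<in> ups a b c (int s)" using Y i(1) by (auto simp: Y_def)
      \<comment> \<open>A step moves at most one position, so only these bounds can be violated.
        Either upper bound gives \<open>x X i - 2 * int j > int s - int j\<close>, because
        \<open>j \<le> s\<close> and \<open>j \<le> a\<close>.\<close>
      then have xi: "x X i < 0 \<or> 2 * int s < x X i \<or> int s + int a < x X i"
        using i(2) by (auto simp: ups_def downs_def x_def split: if_splits)
      have "dt n (\<lambda>i j. real (binom (s - j) (x X i - 2 * int j))) = 0"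
        by (rule dt_zero_row[OF i(1)]) (use xi n_le in \<open>auto intro!: binom_eq_0\<close>)
      then show ?thesis using out by (simp add: T_eq)
    next
      case ok
      \<comment> \<open>Steps of size 0 or 1 cannot reverse the order of the paths; excluding
        collisions keeps it strict, so the rows are already sorted for the induction
        hypothesis.\<close>
      have mono: "strict_mono_on {0..<n} (x X)"
      proof (rule strict_mono_onI)
        fix i k assume ik: "i \<in> {0..<n}" "k \<in> {0..<n}" "i < k"
        then have "y i < y k" using Suc.prems(3) by (auto simp: strict_mono_on_def)
        then have "x X i \<le> x X k" by (auto simp: x_def)
        moreover have "x X i \<noteq> x X k" using ok(1) ik by (auto dest: inj_onD)
        ultimately show "x X i < x X k" by simp
      qed
      have s: "0 \<le> int s" "int s \<le> int (b + c)" using Suc.prems(1) by simp_all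
      note de = downs_eq[OF a s]
      show ?thesis
      proof (cases "s \<le> a")
        case False
        then have E: "entry_pos a s = {}" by (simp add: entry_pos_def)
        \<comment> \<open>After line \<open>a\<close> no path enters, and the number of paths is
          \<open>a + 1\<close> on both lines.\<close>
        have "real (num_tilings (partial_region a b c (int s) (x X ` {0..<n}))) =
            dt n (\<lambda>i j. real (binom (s - j) (x X i - 2 * int j)))"
          by (rule Suc.IH) (use False Suc.prems mono ok(2) de E in auto)
        then show ?thesis using ok by (simp add: T_eq E)
      next
        case True
        then have E: "entry_pos a s = {2 * int s}" and n: "n = Suc s"
          using Suc.prems by (auto simp: entry_pos_def)
        \<comment> \<open>In the last column the upper index \<open>s - j\<close> is 0, so the
          column indicates which path is at the entry position. It is zero if there is none;
          otherwise it is a unit vector, and deleting it removes the newly entered path.\<close>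
        have last: "binom 0 (x X i - 2 * int s) = (if x X i = 2 * int s then 1 else 0)" for i
          by (auto simp: binom_def)
        have le: "x X i \<le> 2 * int s" if "i < n" for i
          using ok(2) that by (auto simp: downs_def image_subset_iff)
        show ?thesis
        proof (cases "2 * int s \<in> x X ` {0..<n}")
          case False
          then have "x X i \<noteq> 2 * int s" if "i < n" for i
            using that by force
          then have "dt n (\<lambda>i j. real (binom (s - j) (x X i - 2 * int j))) = 0"
            by (intro dt_zero_column[of s]) (simp_all add: n last)
          then show ?thesis using False by (simp add: T_eq E)
        next
          case True
          then obtain i where i: "i < n" "x X i = 2 * int s" by auto
          have less: "x X i < x X s" if "i < s" for i
            using mono that by (auto simp: strict_mono_on_def n)
          \<comment> \<open>The positions increase and are at most \<open>2 * int s\<close>, so only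
            the last one can attain this value.\<close>
          have "i = s" using i n less[of i] le[of s] by force
          then have xs: "x X s = 2 * int s" using i by simp
          have ne: "x X i \<noteq> 2 * int s" if "i < s" for i
            using less[OF that] xs by simp
          have "dt n (\<lambda>i j. real (binom (s - j) (x X i - 2 * int j))) =
              dt s (\<lambda>i j. real (binom (s - j) (x X i - 2 * int j)))"
            unfolding n
          proof (rule dt_last_column)
            show "real (binom (s - s) (x X i - 2 * int s)) = 0" if "i < s" for i
              using ne[OF that] by (simp add: last)
          qed (simp add: xs binom_def)
          also have "\<dots> = real (num_tilings (partial_region a b c (int s) (x X ` {0..<s})))"
          proof (rule Suc.IH[symmetric])
            show "s = min s (a + 1)" using \<open>s \<le> a\<close> by simp
            show "strict_mono_on {0..<s} (x X)"
              using mono by (auto simp: strict_mono_on_def n)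
            show "x X ` {0..<s} \<subseteq> ups a b c (int s - 1)"
            proof
              fix k assume "k \<in> x X ` {0..<s}"
              then obtain i where i: "i < s" "k = x X i" by auto
              then have "k \<in> downs a b c s" using ok(2) by (auto simp: n)
              moreover have "k \<noteq> 2 * int s" using ne[OF i(1)] i(2) by simp
              ultimately show "k \<in> ups a b c (int s - 1)" using de E by auto
            qed
          qed (use Suc.prems in simp)
          also have "x X ` {0..<s} = x X ` {0..<n} - entry_pos a s"
            using xs ne unfolding E n by (auto simp: less_Suc_eq)
          finally show ?thesis using ok True by (simp add: T_eq E)
        qed
      qed
    qed
  qed
  have "real (num_tilings (partial_region a b c (int (Suc s)) (y ` {0..<n}))) = (\<Sum>X\<in>Pow Y. real (T X))"
    using num_tilings_strip[OF a _ _ Y] Suc.prems(1) by (simp add: T_def Y_def add.commute)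
  also have "\<dots> = (\<Sum>X\<in>Pow {0..<n}. real (T (y ` X)))"
    unfolding Y_def using bij_betw_Pow[OF inj_on_imp_bij_betw[OF inj]]
    by (rule sum.reindex_bij_betw[symmetric])
  also have "\<dots> = (\<Sum>X\<in>Pow {0..<n}. dt n (\<lambda>i j. real (binom (s - j) (x X i - 2 * int j))))"
    by (rule sum.cong) (simp_all add: term_eq)
  also have "\<dots> = dt n (\<lambda>i j. real (binom (s - j) (y i - 2 * int j)) + real (binom (s - j) (y i - 1 - 2 * int j)))"
    unfolding dt_add_rows by (intro sum.cong dt_cong) (auto simp: x_def)
  also have "\<dots> = dt n (\<lambda>i j. real (binom (Suc s - j) (y i - 2 * int j)))"
  proof (rule dt_cong)
    fix i j assume "j < n"
    then have "Suc s - j = Suc (s - j)" using n_le by simp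
    then show "real (binom (s - j) (y i - 2 * int j)) + real (binom (s - j) (y i - 1 - 2 * int j)) =
        real (binom (Suc s - j) (y i - 2 * int j))"
      by (simp add: binom_pascal algebra_simps)
  qed
  finally show ?case .
qed

lemma S_region_eq_partial:
  assumes "a \<le> b + 1"
  shows "S_region a b c = partial_region a b c (int (b + c + 1)) (ups a b c (int (b + c)) - {int (b + 1)})"
proof -
  \<comment> \<open>The northeast side lies on the line \<open>i + k = b + c + 1\<close>, so no
    triangle belongs to a strip beyond \<open>b + c\<close>.\<close>
  have r: "r \<le> int (b + c)" if "k \<in> ups a b c r \<or> k \<in> downs a b c r" for k r
    using that by (auto simp: ups_def downs_def)
  show ?thesis
    unfolding S_region_eq[OF assms]
  proof (intro region_eqI partial_region_subset)
    show "{up_at s k |s k. k \<in> ups a b c s} \<union> {down_at s k |s k. k \<in> downs a b c s} -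
        {up_at (int (b + c)) (int (b + 1))} \<subseteq> unit_triangles"
      unfolding unit_triangles_eq by blast
  qed (use r in force)+
qed

text \<open>Heights of the edges of the northeast side, except for the dent.\<close>
definition dent_pos :: "nat \<Rightarrow> nat \<Rightarrow> int" where
  "dent_pos b i = int b + (if i = 0 then 0 else int i + 1)"

lemma strict_mono_dent_pos: "strict_mono_on A (dent_pos b)"
  by (auto simp: strict_mono_on_def dent_pos_def)

lemma dent_pos_image:
  assumes "0 < n"
  shows "dent_pos b ` {0..<n} = {int b..int (b + n)} - {int (b + 1)}"
proof (rule Set.set_eqI)
  fix k
  show "k \<in> dent_pos b ` {0..<n} \<longleftrightarrow> k \<in> {int b..int (b + n)} - {int (b + 1)}"
  proof
    assume k: "k \<in> {int b..int (b + n)} - {int (b + 1)}"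
    show "k \<in> dent_pos b ` {0..<n}"
    proof (cases "k = int b")
      case True
      then show ?thesis using assms by (auto simp: dent_pos_def image_iff)
    next
      case False
      with k have "k = dent_pos b (nat (k - int b - 1))" "nat (k - int b - 1) < n"
        by (auto simp: dent_pos_def)
      then show ?thesis by auto
    qed
  qed (auto simp: dent_pos_def split: if_splits)
qed

text \<open>The minimum differs from \<open>a + 1\<close> only for \<open>a = b + 1\<close> and
  \<open>c = 0\<close>, when the last zigzag edge lies on the northeast side itself.\<close>

lemma num_tilings_S_region:
  assumes a: "a \<le> b + 1" and n_def: "n = min (b + c + 1) (a + 1)"
  shows "real (num_tilings (S_region a b c)) =
    dt n (\<lambda>i j. real (binom (b + c + 1 - j) (dent_pos b i - 2 * int j)))"
proof -
  \<comment> \<open>The last strip offers \<open>n + 1\<close> heights; the dent leaves one for each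
    of the \<open>n\<close> paths.\<close>
  have "ups a b c (int (b + c)) = {int b..int (b + n)}"
    using a by (auto simp: ups_def n_def)
  moreover have "0 < n" by (simp add: n_def)
  ultimately have pos: "ups a b c (int (b + c)) - {int (b + 1)} = dent_pos b ` {0..<n}"
    by (simp add: dent_pos_image)
  show ?thesis
    unfolding S_region_eq_partial[OF a] pos
  proof (rule num_tilings_partial_region[OF a])
    have "int (b + c + 1) - 1 = int (b + c)" by simp
    then show "dent_pos b ` {0..<n} \<subseteq> ups a b c (int (b + c + 1) - 1)"
      using pos by auto
  qed (simp_all add: n_def strict_mono_dent_pos)
qed

text \<open>For \<open>a = b + 1\<close> the last path ends at the height where it starts, so the last column is a unit
  vector; for \<open>c = 0\<close> that path is empty and the column is absent.\<close>
lemma num_tilings_S_region_Suc: "num_tilings (S_region (b + 1) b c) = num_tilings (S_region b b c)"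
proof -
  let ?F = "\<lambda>i j. real (binom (b + c + 1 - j) (dent_pos b i - 2 * int j))"
  have "dt (min (b + c + 1) (b + 1 + 1)) ?F = dt (Suc b) ?F"
  proof (cases "c = 0")
    case False
    then have "min (b + c + 1) (b + 1 + 1) = Suc (Suc b)" by simp
    moreover have "dt (Suc (Suc b)) ?F = dt (Suc b) ?F"
      by (rule dt_last_column) (auto simp: dent_pos_def binom_def)
    ultimately show ?thesis by simp
  qed simp
  then have "real (num_tilings (S_region (b + 1) b c)) = real (num_tilings (S_region b b c))"
    using num_tilings_S_region[of "b + 1" b _ c, OF _ refl] num_tilings_S_region[of b b _ c, OF _ refl]
    by (simp add: min_def)
  then show ?thesis by simp
qed

theorem theorem2p1:
  "(\<forall>a b c :: nat. a \<le> b \<longrightarrow>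
      real (num_tilings (S_region a b c)) =
        (int_pochhammer (real c + real a + 2) (int b - int a)
           * int_pochhammer (2 * real c + real b + 3) (int a - 1)
           * ((2 * real b - real a + 2) * real c + (real b + 1) * (real b + 2)))
        / (int_pochhammer (real a + 2) (int b - int a + 1)
           * int_pochhammer (real b + 3) (int a - 1))
        * (\<Prod>i = 1..a.
             (int_pochhammer (real c + real i) (int b - int a + 1)
                * int_pochhammer (2 * real c + real b - real a + 1 + real i) (int i - 1))
             / (int_pochhammer (real i) (int b - int a + 1)
                * int_pochhammer (real b - real a + 1 + real i) (int i - 1))))
   \<and> (\<forall>b c :: nat. num_tilings (S_region (b + 1) b c) = num_tilings (S_region b b c))"
proof (intro conjI allI impI)
  fix a b c :: nat
  assume "a \<le> b"
  then obtain d where b: "b = a + d" by (auto simp: le_iff_add)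
  have "real (num_tilings (S_region a b c)) =
      dt (Suc a) (\<lambda>i j. real (binom (b + c + 1 - j) (dent_pos b i - 2 * int j)))"
    using \<open>a \<le> b\<close> by (intro num_tilings_S_region) auto
  also have "\<dots> = dt (Suc a) (\<lambda>j i. real (binom (b + c + 1 - j) (dent_pos b i - 2 * int j)))"
    by (rule dt_transpose)
  also have "\<dots> = (real a + 1) * (real (2 * d + a + 2) * real c + real (a + d + 1) * real (a + d + 2))
     / (real (a + d + 2 * c + 2) * real (c + a + 1)) * (\<Prod>j\<le>a. proctor_factor d c j)"
    unfolding b dent_pos_def by (rule dt_binom_eval)
  also note pochhammer_formula[OF b, of c, symmetric]
  finally show "real (num_tilings (S_region a b c)) =
        (int_pochhammer (real c + real a + 2) (int b - int a)
           * int_pochhammer (2 * real c + real b + 3) (int a - 1)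
           * ((2 * real b - real a + 2) * real c + (real b + 1) * (real b + 2)))
        / (int_pochhammer (real a + 2) (int b - int a + 1)
           * int_pochhammer (real b + 3) (int a - 1))
        * (\<Prod>i = 1..a.
             (int_pochhammer (real c + real i) (int b - int a + 1)
                * int_pochhammer (2 * real c + real b - real a + 1 + real i) (int i - 1))
             / (int_pochhammer (real i) (int b - int a + 1)
                * int_pochhammer (real b - real a + 1 + real i) (int i - 1)))" .
qed (rule num_tilings_S_region_Suc)

end
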